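(* Let $m_-, m_+$ be strictly positive integers, $\phi : \{0,\ldots,m_+-1\} \to \{0,\ldots,m_--1\}$ a surjective function, and $p^+ = (p^+_0,\ldots,p^+_{m_+-1})$ a probability distribution on $\{0,\ldots,m_+-1\}$. Let $\sigma_\phi : \Sigma_{m_-,m_+} \to \Sigma_{m_-,m_+}$ be the $(m_-,m_+)$-extended shift with transition function $\phi$ and let $\mu$ be the probability measure on $\Sigma_{m_-,m_+}$ induced by $p^+$. Then the metric (Kolmogorov--Sinai) entropy of $\sigma_\phi$ with respect to $\mu$ is $$h_\mu(\sigma_\phi) = H_\mu(\mathcal C_0) = \sum_{s=0}^{m_+-1} -p^+_s \log(p^+_s).$$
   Context: Extended shift. $\Sigma_{m_-,m_+} := \{0,\ldots,m_--1\}^{\mathbb Z_{<0}} \times \{0,\ldots,m_+-1\}^{\mathbb Z_{\ge 0}}$; its elements are written as bilateral sequences $x = (\ldots,x_{-2},x_{-1};x_0,x_1,\ldots)$ with $x_i \in \{0,\ldots,m_--1\}$ for $i<0$ and $x_i \in \{0,\ldots,m_+-1\}$ for $i \ge 0$. The map $\sigma_\phi$ is $\sigma_\phi(\ldots,x_{-2},x_{-1};x_0,x_1,\ldots) := (\ldots,x_{-1},\phi(x_0);x_1,x_2,\ldots)$. Measure. For $i \in \mathbb Z$ and $s$ a symbol of the alphabet allowed at position $i$, the cylinder is $C_i^s := \{x \in \Sigma_{m_-,m_+} : x_i = s\}$; the $\sigma$-algebra $\mathcal B$ is generated by the cylinders. The distribution $p^- = (p^-_0,\ldots,p^-_{m_--1})$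 is the pushforward of $p^+$ by $\phi$: $p^-_z := \sum_{s \in \phi^{-1}(z)} p^+_s$. The measure $\mu$ induced by $p^+$ is the product measure with $\mu(C_i^s) = p^-_s$ for $i<0$ and $\mu(C_i^s) = p^+_s$ for $i \ge 0$ (so cylinders at distinct indices are independent). It is $\sigma_\phi$-invariant. Entropy. $\mathcal C_0 := \{C_0^s : s \in \{0,\ldots,m_+-1\}\}$. For a finite or countable measurable partition $\mathcal P$, $H_\mu(\mathcal P) := \sum_{P \in \mathcal P} -\mu(P)\log \mu(P)$, with $0\log 0 = 0$. $h_\mu(f)$ is the usual Kolmogorov--Sinai entropy: $h_\mu(f) := \sup_{\mathcal P} \lim_{n\to\infty} \frac1n H_\mu\big(\bigvee_{i=0}^{n-1} f^{-i}(\mathcal P)\big)$, the supremum over partitions $\mathcal P$ with finite entropy. *)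

theory Defs
  imports "HOL-Probability.Probability" "HOL-Library.Disjoint_Sets"
begin

definition countable_partition :: "'a measure \<Rightarrow> 'a set set \<Rightarrow> bool" where
  "countable_partition M P \<longleftrightarrow> countable P \<and> P \<subseteq> sets M \<and> partition_on (space M) P"

text \<open>Used only for probability measures, where every summand is nonnegative, so that nothing is
  truncated by \<^const>\<open>ennreal\<close>. The convention \<open>0 log 0 = 0\<close> holds because \<open>ln 0 = 0\<close>.\<close>

definition partition_entropy :: "'a measure \<Rightarrow> 'a set set \<Rightarrow> ennreal" where
  "partition_entropy M P = (\<Sum>\<^sub>\<infinity>A\<in>P. ennreal (- measure M A * ln (measure M A)))"

definition pullback_partition :: "'a measure \<Rightarrow> ('a \<Rightarrow> 'a) \<Rightarrow> 'a set set \<Rightarrow> 'a set set" where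
  "pullback_partition M g P = (\<lambda>A. g -` A \<inter> space M) ` P"

text \<open>For \<open>n = 0\<close> this is \<open>{UNIV}\<close>, which may differ from \<open>{space M}\<close>; only the limit in \<open>n\<close> is used.\<close>

definition iterated_partition :: "'a measure \<Rightarrow> ('a \<Rightarrow> 'a) \<Rightarrow> 'a set set \<Rightarrow> nat \<Rightarrow> 'a set set" where
  "iterated_partition M f P n = common_refinement ((\<lambda>i. pullback_partition M (f ^^ i) P) ` {..<n})"

definition ks_entropy :: "'a measure \<Rightarrow> ('a \<Rightarrow> 'a) \<Rightarrow> ennreal" where
  "ks_entropy M f =
    (SUP P \<in> {P. countable_partition M P \<and> partition_entropy M P < \<infinity>}.
       lim (\<lambda>n. partition_entropy M (iterated_partition M f P n) / of_nat n))"

definition alphabet :: "nat \<Rightarrow> nat \<Rightarrow> int \<Rightarrow> nat set" where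
  "alphabet m_minus m_plus i = (if i < 0 then {..<m_minus} else {..<m_plus})"

definition ext_space :: "nat \<Rightarrow> nat \<Rightarrow> (int \<Rightarrow> nat) set" where
  "ext_space m_minus m_plus = {x. \<forall>i. x i \<in> alphabet m_minus m_plus i}"

definition ext_shift :: "(nat \<Rightarrow> nat) \<Rightarrow> (int \<Rightarrow> nat) \<Rightarrow> (int \<Rightarrow> nat)" where
  "ext_shift \<phi> x = (\<lambda>i. if i = -1 then \<phi> (x 0) else x (i + 1))"

definition cylinder :: "nat \<Rightarrow> nat \<Rightarrow> int \<Rightarrow> nat \<Rightarrow> (int \<Rightarrow> nat) set" where
  "cylinder m_minus m_plus i s = {x \<in> ext_space m_minus m_plus. x i = s}"

definition zero_partition :: "nat \<Rightarrow> nat \<Rightarrow> (int \<Rightarrow> nat) set set" where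
  "zero_partition m_minus m_plus = cylinder m_minus m_plus 0 ` {..<m_plus}"

definition pushforward_distr :: "nat \<Rightarrow> (nat \<Rightarrow> nat) \<Rightarrow> (nat \<Rightarrow> real) \<Rightarrow> nat \<Rightarrow> real" where
  "pushforward_distr m_plus \<phi> p z = (\<Sum>s\<in>{s\<in>{..<m_plus}. \<phi> s = z}. p s)"

definition symbol_distr :: "nat \<Rightarrow> (nat \<Rightarrow> nat) \<Rightarrow> (nat \<Rightarrow> real) \<Rightarrow> int \<Rightarrow> nat \<Rightarrow> real" where
  "symbol_distr m_plus \<phi> p i = (if i < 0 then pushforward_distr m_plus \<phi> p else p)"

definition ext_measure :: "nat \<Rightarrow> nat \<Rightarrow> (nat \<Rightarrow> nat) \<Rightarrow> (nat \<Rightarrow> real) \<Rightarrow> (int \<Rightarrow> nat) measure" where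
  "ext_measure m_minus m_plus \<phi> p =
    (\<Pi>\<^sub>M i\<in>UNIV. point_measure (alphabet m_minus m_plus i) (\<lambda>s. ennreal (symbol_distr m_plus \<phi> p i s)))"

lemma finite_alphabet [simp]: "finite (alphabet m_minus m_plus i)"
  by (simp add: alphabet_def)

lemma ext_shift_in_ext_space:
  assumes "\<phi> ` {..<m_plus} \<subseteq> {..<m_minus}" "x \<in> ext_space m_minus m_plus"
  shows "ext_shift \<phi> x \<in> ext_space m_minus m_plus"
proof -
  have x: "x i \<in> alphabet m_minus m_plus i" for i
    using assms(2) by (simp add: ext_space_def)
  have "ext_shift \<phi> x i \<in> alphabet m_minus m_plus i" for i
    using x[of 0] x[of "i + 1"] assms(1) by (auto simp: ext_shift_def alphabet_def split: if_splits)
  then show ?thesis by (simp add: ext_space_def)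
qed

lemma space_ext_measure: "space (ext_measure m_minus m_plus \<phi> p) = ext_space m_minus m_plus"
  by (auto simp: ext_measure_def ext_space_def space_PiM space_point_measure)

lemma sets_ext_measure:
  "sets (ext_measure m_minus m_plus \<phi> p) =
    sigma_sets (ext_space m_minus m_plus)
      {cylinder m_minus m_plus i s | i s. s \<in> alphabet m_minus m_plus i}"
    (is "_ = sigma_sets ?S ?G")
proof -
  let ?M = "\<lambda>i. point_measure (alphabet m_minus m_plus i) (\<lambda>s. ennreal (symbol_distr m_plus \<phi> p i s))"
  have S: "(\<Pi>\<^sub>E i\<in>UNIV. space (?M i)) = ?S"
    by (auto simp: ext_space_def space_point_measure)
  have eq: "sets (ext_measure m_minus m_plus \<phi> p) =
      sigma_sets ?S {{x \<in> ?S. x i \<in> A} | i A. A \<subseteq> alphabet m_minus m_plus i}"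
    unfolding ext_measure_def sets_PiM_single S by (simp add: sets_point_measure)
  show ?thesis unfolding eq
  proof (rule sigma_sets_eqI)
    fix a assume "a \<in> {{x \<in> ?S. x i \<in> A} | i A. A \<subseteq> alphabet m_minus m_plus i}"
    then obtain i A where a: "a = {x \<in> ?S. x i \<in> A}" and A: "A \<subseteq> alphabet m_minus m_plus i"
      by blast
    have "finite A" using A finite_alphabet finite_subset by blast
    moreover have "a = (\<Union>s\<in>A. cylinder m_minus m_plus i s)"
      by (auto simp: a cylinder_def)
    moreover have "cylinder m_minus m_plus i s \<in> sigma_sets ?S ?G" if "s \<in> A" for s
      using that A by (intro sigma_sets.Basic) blast
    ultimately show "a \<in> sigma_sets ?S ?G"
      by (auto intro!: sigma_sets_UNION countable_finite)
  next
    fix b assume "b \<in> ?G"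
    then obtain i s where "b = cylinder m_minus m_plus i s" "s \<in> alphabet m_minus m_plus i"
      by blast
    then have "b = {x \<in> ?S. x i \<in> {s}}" "{s} \<subseteq> alphabet m_minus m_plus i"
      by (auto simp: cylinder_def)
    then show "b \<in> sigma_sets ?S {{x \<in> ?S. x i \<in> A} | i A. A \<subseteq> alphabet m_minus m_plus i}"
      by (intro sigma_sets.Basic) blast
  qed
qed

lemma symbol_distr_prob:
  assumes "\<phi> ` {..<m_plus} \<subseteq> {..<m_minus}"
    and "\<forall>s<m_plus. 0 \<le> p s" and "(\<Sum>s<m_plus. p s) = 1"
  shows "\<And>s. s \<in> alphabet m_minus m_plus i \<Longrightarrow> 0 \<le> symbol_distr m_plus \<phi> p i s"
    and "(\<Sum>s\<in>alphabet m_minus m_plus i. symbol_distr m_plus \<phi> p i s) = 1"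
proof -
  show "0 \<le> symbol_distr m_plus \<phi> p i s" if "s \<in> alphabet m_minus m_plus i" for s
    using that assms(2)
    by (auto simp: symbol_distr_def pushforward_distr_def alphabet_def intro!: sum_nonneg split: if_splits)
  have "(\<Sum>z<m_minus. pushforward_distr m_plus \<phi> p z) = (\<Sum>s<m_plus. p s)"
    unfolding pushforward_distr_def by (rule sum.group) (use assms(1) in auto)
  then show "(\<Sum>s\<in>alphabet m_minus m_plus i. symbol_distr m_plus \<phi> p i s) = 1"
    using assms(3) by (simp add: alphabet_def symbol_distr_def)
qed

lemma product_prob_space_ext_measure:
  assumes "\<phi> ` {..<m_plus} \<subseteq> {..<m_minus}"
    and "\<forall>s<m_plus. 0 \<le> p s" and "(\<Sum>s<m_plus. p s) = 1"
  shows "product_prob_space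
    (\<lambda>i. point_measure (alphabet m_minus m_plus i) (\<lambda>s. ennreal (symbol_distr m_plus \<phi> p i s)))"
proof -
  have "prob_space
    (point_measure (alphabet m_minus m_plus i) (\<lambda>s. ennreal (symbol_distr m_plus \<phi> p i s)))" for i
    using symbol_distr_prob[OF assms, where i = i]
    by (intro prob_spaceI) (simp add: space_point_measure emeasure_point_measure_finite sum_ennreal)
  then show ?thesis
    unfolding product_prob_space_def product_prob_space_axioms_def product_sigma_finite_def
    by (auto intro: prob_space_imp_sigma_finite)
qed

lemma prob_space_ext_measure:
  assumes "\<phi> ` {..<m_plus} \<subseteq> {..<m_minus}"
    and "\<forall>s<m_plus. 0 \<le> p s" and "(\<Sum>s<m_plus. p s) = 1"
  shows "prob_space (ext_measure m_minus m_plus \<phi> p)"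
proof -
  interpret product_prob_space
    "\<lambda>i. point_measure (alphabet m_minus m_plus i) (\<lambda>s. ennreal (symbol_distr m_plus \<phi> p i s))" UNIV
    by (rule product_prob_space_ext_measure[OF assms])
  show ?thesis unfolding ext_measure_def by (rule P.prob_space_axioms)
qed

lemma measure_cylinder:
  assumes "\<phi> ` {..<m_plus} \<subseteq> {..<m_minus}"
    and "\<forall>s<m_plus. 0 \<le> p s" and "(\<Sum>s<m_plus. p s) = 1"
    and s: "s \<in> alphabet m_minus m_plus i"
  shows "measure (ext_measure m_minus m_plus \<phi> p) (cylinder m_minus m_plus i s) =
    (if i < 0 then pushforward_distr m_plus \<phi> p s else p s)"
proof -
  let ?M = "\<lambda>i. point_measure (alphabet m_minus m_plus i) (\<lambda>s. ennreal (symbol_distr m_plus \<phi> p i s))"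
  interpret product_prob_space ?M UNIV
    by (rule product_prob_space_ext_measure[OF assms(1-3)])
  have "cylinder m_minus m_plus i s = {x \<in> space (Pi\<^sub>M UNIV ?M). x i \<in> {s}}"
    using space_ext_measure[of m_minus m_plus \<phi> p] by (auto simp: cylinder_def ext_measure_def)
  then have "emeasure (ext_measure m_minus m_plus \<phi> p) (cylinder m_minus m_plus i s) = emeasure (?M i) {s}"
    unfolding ext_measure_def using s
    by (simp only:) (rule emeasure_PiM_Collect_single, auto simp: sets_point_measure)
  also have "\<dots> = ennreal (symbol_distr m_plus \<phi> p i s)"
    using s by (simp add: emeasure_point_measure_finite)
  finally show ?thesis
    using symbol_distr_prob(1)[OF assms(1-3) s] by (simp add: measure_def symbol_distr_def)
qed

end

(* Entropy is written as the integral of - ln mu(atom), for labellings of the space by a countable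
   type. In this form it is monotone, invariant, and subadditive even when infinite, and Fekete's
   lemma gives the limit along the iterates of a partition.

   The partition by coordinate 0 is not a generator, since its preimages under the iterates of the
   shift never reveal the negative coordinates. The entropy bound is therefore proved directly: a
   countable partition of finite entropy agrees, up to an error partition of small entropy, with one
   that depends only on the coordinates in [-N, N]. The n-th iterate of the latter is determined by
   the coordinates in [-N, N + n), so its entropy is at most N H(p^-) + (N + n) H(p^+): the negative
   coordinates contribute only a bounded amount. *)

theory Submission
  imports Defs
begin

text \<open>Conditional entropy is avoided. An approximation \<open>X'\<close> of \<open>X\<close>
  is completed by two error labels so that the three together determine \<open>X\<close>;
  monotonicity and subadditivity are then the only inequalities needed. The choices are made in a
  fixed order: truncation level \<open>K\<close>, mismatch probability \<open>d\<close>, window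
  \<open>N\<close>, and last \<open>n\<close> tending to infinity. The errors are paid at every time
  but cost at most \<open>e\<close> per step, while the window cost is constant in \<open>n\<close>
  and disappears on division. The \<open>lim\<close> in \<open>ks_entropy\<close> is a definite
  description, so convergence has to be known before any bound can be passed to it. The convention
  \<open>ln 0 = 0\<close> can spoil the monotonicity of the information \<open>- ln\<close> on null
  fibres, so pointwise comparisons are made almost everywhere. For the lower bound, the partition by
  coordinate 0 reveals exactly the coordinates 0 to \<open>n - 1\<close>, which are independent, so
  its \<open>n\<close>-th entropy is computed and not only estimated.\<close>

section \<open>Entropy of labellings\<close>

text \<open>\<open>partition_entropy\<close> is an unordered sum; as an integral for counting
  measure it can be exchanged with other integrals. Both sides are suprema of finite partial sums,
  for the integral along an enumeration of \<open>A\<close>.\<close>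

lemma infsum_ennreal_eq_nn_integral:
  fixes f :: "'a \<Rightarrow> ennreal"
  assumes "countable A"
  shows "infsum f A = (\<integral>\<^sup>+x. f x \<partial>count_space A)"
proof (rule antisym)
  have "infsum f A = (SUP F\<in>{F. finite F \<and> F \<subseteq> A}. sum f F)"
    by (rule nonneg_infsum_complete) simp
  also have "\<dots> \<le> (\<integral>\<^sup>+x. f x \<partial>count_space A)"
  proof (rule SUP_least)
    fix F assume "F \<in> {F. finite F \<and> F \<subseteq> A}"
    then have F: "finite F" "F \<subseteq> A" by auto
    have "sum f F = (\<integral>\<^sup>+x. f x * indicator F x \<partial>count_space A)"
      using F by (subst nn_integral_count_space'[of F]) (auto intro!: sum.cong)
    also have "\<dots> \<le> (\<integral>\<^sup>+x. f x \<partial>count_space A)"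
      by (intro nn_integral_mono) (auto split: split_indicator)
    finally show "sum f F \<le> (\<integral>\<^sup>+x. f x \<partial>count_space A)" .
  qed
  finally show "infsum f A \<le> (\<integral>\<^sup>+x. f x \<partial>count_space A)" .
next
  have le: "sum f F \<le> infsum f A" if "finite F" "F \<subseteq> A" for F
    using that by (subst nonneg_infsum_complete) (auto intro: SUP_upper)
  show "(\<integral>\<^sup>+x. f x \<partial>count_space A) \<le> infsum f A"
  proof (cases "finite A")
    case True
    then show ?thesis using le[of A] by (simp add: nn_integral_count_space_finite)
  next
    case False
    then have bij: "bij_betw (from_nat_into A) UNIV A"
      using assms by (intro bij_betw_from_nat_into)
    then have inj: "inj (from_nat_into A)" and ran: "range (from_nat_into A) = A"
      by (auto simp: bij_betw_def)
    have "(\<integral>\<^sup>+x. f x \<partial>count_space A) = (\<integral>\<^sup>+n. f (from_nat_into A n) \<partial>count_space UNIV)"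
      by (rule nn_integral_bij_count_space[OF bij, symmetric])
    also have "\<dots> = (SUP n. \<Sum>i<n. f (from_nat_into A i))"
      by (simp add: nn_integral_count_space_nat suminf_eq_SUP)
    also have "\<dots> \<le> infsum f A"
    proof (rule SUP_least)
      fix n
      have "(\<Sum>i<n. f (from_nat_into A i)) = sum f (from_nat_into A ` {..<n})"
        by (rule sum.reindex_cong[symmetric, OF _ refl refl]) (rule inj_on_subset[OF inj], simp)
      then show "(\<Sum>i<n. f (from_nat_into A i)) \<le> infsum f A"
        using le[of "from_nat_into A ` {..<n}"] ran by auto
    qed
    finally show ?thesis .
  qed
qed

definition fibre :: "'a measure \<Rightarrow> ('a \<Rightarrow> 'b) \<Rightarrow> 'b \<Rightarrow> 'a set" where
  "fibre M X a = X -` {a} \<inter> space M"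

text \<open>Indexing by attained values keeps empty blocks out and makes \<open>fibre M X\<close>
  injective on the index set.\<close>

definition fibre_partition :: "'a measure \<Rightarrow> ('a \<Rightarrow> 'b) \<Rightarrow> 'a set set" where
  "fibre_partition M X = fibre M X ` (X ` space M)"

text \<open>Shannon entropy as the mean of the information function. Points in null fibres
  contribute 0 because \<open>ln 0 = 0\<close>; for a countable label they form a null set.\<close>

definition label_entropy :: "'a measure \<Rightarrow> ('a \<Rightarrow> 'b) \<Rightarrow> ennreal" where
  "label_entropy M X = (\<integral>\<^sup>+x. ennreal (- ln (measure M (fibre M X (X x)))) \<partial>M)"

abbreviation labelling :: "'a measure \<Rightarrow> ('a \<Rightarrow> 'b::countable) \<Rightarrow> bool" where
  "labelling M X \<equiv> X \<in> measurable M (count_space UNIV)"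

lemma sets_fibre: "X \<in> measurable M (count_space UNIV) \<Longrightarrow> fibre M X a \<in> sets M"
  unfolding fibre_def by (erule measurable_sets) simp

lemma labelling_iff: "labelling M X \<longleftrightarrow> (\<forall>a. fibre M X a \<in> sets M)"
  unfolding fibre_def by (subst measurable_count_space_eq2_countable) auto

lemma labelling_Pair:
  assumes "labelling M X" "labelling M Y"
  shows "labelling M (\<lambda>x. (X x, Y x))"
proof -
  have "fibre M (\<lambda>x. (X x, Y x)) (a, b) = fibre M X a \<inter> fibre M Y b" for a b
    by (auto simp: fibre_def)
  then show ?thesis using assms by (auto simp: labelling_iff)
qed

text \<open>Each fibre of \<open>Y\<close> is a countable union of fibres of \<open>X\<close>, so a
  label computed from measurable ones needs no measurability proof of its own.\<close>

lemma labelling_factor: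
  assumes X: "labelling M X"
    and fac: "\<And>x y. x \<in> space M \<Longrightarrow> y \<in> space M \<Longrightarrow> X x = X y \<Longrightarrow> Y x = Y y"
  shows "labelling M Y"
proof -
  have "fibre M Y a = (\<Union>b\<in>{b. \<exists>x\<in>space M. X x = b \<and> Y x = a}. fibre M X b)" for a
  proof (intro equalityI subsetI)
    fix x assume "x \<in> fibre M Y a"
    then have "X x \<in> {b. \<exists>x\<in>space M. X x = b \<and> Y x = a}" "x \<in> fibre M X (X x)"
      by (auto simp: fibre_def)
    then show "x \<in> (\<Union>b\<in>{b. \<exists>x\<in>space M. X x = b \<and> Y x = a}. fibre M X b)" by blast
  next
    fix x assume "x \<in> (\<Union>b\<in>{b. \<exists>x\<in>space M. X x = b \<and> Y x = a}. fibre M X b)"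
    then obtain y where "y \<in> space M" "Y y = a" "X x = X y" "x \<in> space M"
      by (auto simp: fibre_def)
    then show "x \<in> fibre M Y a" using fac[of x y] by (simp add: fibre_def)
  qed
  moreover have "(\<Union>b\<in>{b. \<exists>x\<in>space M. X x = b \<and> Y x = a}. fibre M X b) \<in> sets M" for a
    using X by (intro sets.countable_UN') (auto simp: labelling_iff)
  ultimately show ?thesis by (simp add: labelling_iff)
qed

text \<open>\<open>h (X x)\<close> is the sum over \<open>a\<close> of \<open>h a\<close> times the
  indicator of the fibre over \<open>a\<close>; countability of the label type permits exchanging
  sum and integral.\<close>

lemma nn_integral_labelling:
  fixes X :: "'a \<Rightarrow> 'b::countable"
  assumes X: "labelling M X"
  shows "(\<integral>\<^sup>+x. h (X x) \<partial>M) = (\<integral>\<^sup>+a. h a * emeasure M (fibre M X a) \<partial>count_space UNIV)"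
proof -
  have ind: "h (X x) = (\<integral>\<^sup>+a. h a * indicator (fibre M X a) x \<partial>count_space UNIV)" if "x \<in> space M" for x
    using that by (subst nn_integral_count_space'[of "{X x}"]) (auto simp: fibre_def split: split_indicator)
  have "(\<integral>\<^sup>+x. h (X x) \<partial>M) = (\<integral>\<^sup>+x. \<integral>\<^sup>+a. h a * indicator (fibre M X a) x \<partial>count_space UNIV \<partial>M)"
    by (rule nn_integral_cong) (rule ind)
  also have "\<dots> = (\<integral>\<^sup>+a. \<integral>\<^sup>+x. h a * indicator (fibre M X a) x \<partial>M \<partial>count_space UNIV)"
    using X by (intro nn_integral_count_space_nn_integral) (auto simp: labelling_iff)
  also have "\<dots> = (\<integral>\<^sup>+a. h a * emeasure M (fibre M X a) \<partial>count_space UNIV)"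
    using X by (intro nn_integral_cong nn_integral_cmult_indicator) (auto simp: labelling_iff)
  finally show ?thesis .
qed

lemma borel_measurable_labelling:
  "labelling M X \<Longrightarrow> (\<lambda>x. h (X x)) \<in> measurable M borel"
  by (rule measurable_compose) auto

context prob_space
begin

lemma label_entropy_count_space:
  assumes X: "labelling M X"
  shows "label_entropy M X =
    (\<integral>\<^sup>+a. ennreal (- prob (fibre M X a) * ln (prob (fibre M X a))) \<partial>count_space UNIV)"
  unfolding label_entropy_def nn_integral_labelling[OF X, where h = "\<lambda>a. ennreal (- ln (prob (fibre M X a)))"]
proof (rule nn_integral_cong)
  fix a
  have "ln (prob (fibre M X a)) \<le> 0"
    by (cases "prob (fibre M X a) = 0") (auto simp: zero_less_measure_iff)
  then show "ennreal (- ln (prob (fibre M X a))) * emeasure M (fibre M X a) =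
      ennreal (- prob (fibre M X a) * ln (prob (fibre M X a)))"
    by (simp add: emeasure_eq_measure ennreal_mult''[symmetric] mult.commute)
qed

lemma inj_on_fibre: "inj_on (fibre M X) (X ` space M)"
  by (auto simp: inj_on_def fibre_def)

lemma partition_entropy_fibre_partition:
  assumes X: "labelling M X"
  shows "partition_entropy M (fibre_partition M X) = label_entropy M X"
proof -
  have "partition_entropy M (fibre_partition M X) =
      (\<Sum>\<^sub>\<infinity>a\<in>X ` space M. ennreal (- prob (fibre M X a) * ln (prob (fibre M X a))))"
    unfolding partition_entropy_def fibre_partition_def
    by (subst infsum_reindex[OF inj_on_fibre]) (simp add: o_def)
  also have "\<dots> = (\<integral>\<^sup>+a. ennreal (- prob (fibre M X a) * ln (prob (fibre M X a))) \<partial>count_space (X ` space M))"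
    by (rule infsum_ennreal_eq_nn_integral) simp
  also have "\<dots> = (\<integral>\<^sup>+a. ennreal (- prob (fibre M X a) * ln (prob (fibre M X a))) \<partial>count_space UNIV)"
  proof (rule nn_integral_count_space_eq)
    fix a assume "a \<in> UNIV - X ` space M"
    then have "fibre M X a = {}" by (auto simp: fibre_def)
    then show "ennreal (- prob (fibre M X a) * ln (prob (fibre M X a))) = 0" by simp
  qed simp
  finally show ?thesis by (simp add: label_entropy_count_space[OF X])
qed

text \<open>There are only countably many null fibres, so their union is null. Outside it,
  logarithms can be split and compared without meeting \<open>ln 0 = 0\<close>.\<close>

lemma AE_fibre_pos:
  assumes X: "labelling M X"
  shows "AE x in M. 0 < prob (fibre M X (X x))"
proof -
  have "AE x in M. x \<notin> fibre M X a" if "prob (fibre M X a) = 0" for a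
    using that sets_fibre[OF X] by (intro AE_not_in) (auto simp: null_sets_def emeasure_eq_measure)
  then have "AE x in M. \<forall>a. prob (fibre M X a) = 0 \<longrightarrow> x \<notin> fibre M X a"
    by (subst AE_all_countable) auto
  with AE_space show ?thesis
    by eventually_elim (auto simp: fibre_def zero_less_measure_iff measure_le_0_iff)
qed

text \<open>The fibre of the finer label through a point lies inside that of the coarser one, so the
  information grows pointwise wherever the smaller fibre has positive probability.\<close>

lemma label_entropy_mono:
  fixes X :: "'a \<Rightarrow> 'b::countable" and Y :: "'a \<Rightarrow> 'c::countable"
  assumes X: "labelling M X"
    and fac: "\<And>x y. x \<in> space M \<Longrightarrow> y \<in> space M \<Longrightarrow> X x = X y \<Longrightarrow> Y x = Y y"
  shows "label_entropy M Y \<le> label_entropy M X"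
  unfolding label_entropy_def
proof (rule nn_integral_mono_AE)
  have Y: "labelling M Y" by (rule labelling_factor[OF X fac])
  show "AE x in M. ennreal (- ln (prob (fibre M Y (Y x)))) \<le> ennreal (- ln (prob (fibre M X (X x))))"
    using AE_fibre_pos[OF X] AE_space
  proof eventually_elim
    case (elim x)
    have "fibre M X (X x) \<subseteq> fibre M Y (Y x)"
    proof
      fix y assume "y \<in> fibre M X (X x)"
      then show "y \<in> fibre M Y (Y x)" using fac[of y x] elim(2) by (simp add: fibre_def)
    qed
    then have "prob (fibre M X (X x)) \<le> prob (fibre M Y (Y x))"
      by (rule finite_measure_mono) (rule sets_fibre[OF Y])
    then show ?case using elim(1) by (intro ennreal_leI) simp
  qed
qed

text \<open>Gibbs' inequality in the pointwise form \<open>1 - ln r \<le> - ln p - ln q + p q / r\<close>, where both sides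
  are nonnegative, so that it integrates in \<^typ>\<open>ennreal\<close> without any finiteness assumption.\<close>

lemma label_entropy_Pair_le:
  fixes X :: "'a \<Rightarrow> 'b::countable" and Y :: "'a \<Rightarrow> 'c::countable"
  assumes X: "labelling M X" and Y: "labelling M Y"
  shows "label_entropy M (\<lambda>x. (X x, Y x)) \<le> label_entropy M X + label_entropy M Y"
proof -
  let ?Z = "\<lambda>x. (X x, Y x)"
  let ?p = "\<lambda>a. prob (fibre M X a)" and ?q = "\<lambda>b. prob (fibre M Y b)"
    and ?r = "\<lambda>c. prob (fibre M ?Z c)"
  let ?h = "\<lambda>c. ennreal (?p (fst c) * ?q (snd c) / ?r c)"
  have Z: "labelling M ?Z" by (rule labelling_Pair[OF X Y])
  have sum1: "(\<integral>\<^sup>+a. ennreal (prob (fibre M W a)) \<partial>count_space UNIV) = 1"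
    if "labelling M W" for W :: "'a \<Rightarrow> 'd::countable"
    using nn_integral_labelling[OF that, of "\<lambda>_. 1"] by (simp add: emeasure_eq_measure emeasure_space_1 prob_space)
  have "(\<integral>\<^sup>+x. ?h (?Z x) \<partial>M) = (\<integral>\<^sup>+c. ?h c * ennreal (?r c) \<partial>count_space UNIV)"
    by (subst nn_integral_labelling[OF Z]) (simp add: emeasure_eq_measure)
  \<comment> \<open>Not an equality in general: where \<open>?r c\<close> vanishes, the left summand
    is 0 but the product need not be.\<close>
  also have "\<dots> \<le> (\<integral>\<^sup>+c. ennreal (?p (fst c)) * ennreal (?q (snd c)) \<partial>count_space UNIV)"
    by (intro nn_integral_mono) (auto simp: ennreal_mult''[symmetric] intro!: ennreal_leI)
  also have "\<dots> = (\<integral>\<^sup>+a. \<integral>\<^sup>+b. ennreal (?p a) * ennreal (?q b) \<partial>count_space UNIV \<partial>count_space UNIV)"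
    by (subst nn_integral_fst_count_space[symmetric]) simp
  also have "\<dots> = 1"
    by (simp add: nn_integral_cmult sum1 X Y)
  finally have h: "(\<integral>\<^sup>+x. ?h (?Z x) \<partial>M) \<le> 1" .
  have "label_entropy M ?Z + 1 = (\<integral>\<^sup>+x. ennreal (- ln (?r (?Z x))) + 1 \<partial>M)"
    unfolding label_entropy_def using borel_measurable_labelling[OF Z, of "\<lambda>c. ennreal (- ln (?r c))"]
    by (subst nn_integral_add) (auto simp: emeasure_space_1)
  also have "\<dots> \<le> (\<integral>\<^sup>+x. (ennreal (- ln (?p (X x))) + ennreal (- ln (?q (Y x)))) + ?h (?Z x) \<partial>M)"
  proof (rule nn_integral_mono_AE)
    show "AE x in M. ennreal (- ln (?r (?Z x))) + 1
        \<le> (ennreal (- ln (?p (X x))) + ennreal (- ln (?q (Y x)))) + ?h (?Z x)"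
      using AE_fibre_pos[OF X] AE_fibre_pos[OF Y] AE_fibre_pos[OF Z]
    proof eventually_elim
      case (elim x)
      let ?P = "?p (X x)" and ?Q = "?q (Y x)" and ?R = "?r (?Z x)"
      have "ln (?P * ?Q / ?R) \<le> ?P * ?Q / ?R - 1"
        using elim by (intro ln_le_minus_one) simp
      then have "- ln ?R + 1 \<le> - ln ?P - ln ?Q + ?P * ?Q / ?R"
        using elim by (simp add: ln_mult ln_div)
      then have le: "ennreal (- ln ?R + 1) \<le> ennreal (- ln ?P - ln ?Q + ?P * ?Q / ?R)"
        by (rule ennreal_leI)
      have neg: "ln ?P \<le> 0" "ln ?Q \<le> 0" "ln ?R \<le> 0"
        using elim by (auto simp: ln_le_zero_iff)
      have "ennreal (- ln ?R) + 1 = ennreal (- ln ?R + 1)"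
        using neg by (subst ennreal_plus) auto
      also note le
      also have "ennreal (- ln ?P - ln ?Q + ?P * ?Q / ?R) = ennreal (- ln ?P - ln ?Q) + ennreal (?P * ?Q / ?R)"
        using neg by (intro ennreal_plus) auto
      also have "ennreal (- ln ?P - ln ?Q) = ennreal (- ln ?P) + ennreal (- ln ?Q)"
        using neg ennreal_plus[of "- ln ?P" "- ln ?Q"] by auto
      finally show ?case by simp
    qed
  qed
  also have "\<dots> = label_entropy M X + label_entropy M Y + (\<integral>\<^sup>+x. ?h (?Z x) \<partial>M)"
    unfolding label_entropy_def
    using borel_measurable_labelling[OF X, of "\<lambda>c. ennreal (- ln (?p c))"]
      borel_measurable_labelling[OF Y, of "\<lambda>c. ennreal (- ln (?q c))"]
      borel_measurable_labelling[OF Z, of "?h"]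
    by (simp add: nn_integral_add)
  also have "\<dots> \<le> label_entropy M X + label_entropy M Y + 1"
    using h by (intro add_left_mono)
  finally have "1 + label_entropy M ?Z \<le> 1 + (label_entropy M X + label_entropy M Y)"
    by (subst (1 2) add.commute)
  \<comment> \<open>The constant 1 is finite, so it cancels even if an entropy is infinite.\<close>
  then show ?thesis by (simp only: ennreal_add_left_cancel_le) simp
qed

end

section \<open>Joint labels of finite families\<close>

definition joint :: "(nat \<Rightarrow> 'a \<Rightarrow> 'b) \<Rightarrow> nat \<Rightarrow> 'a \<Rightarrow> 'b list" where
  "joint Y n x = map (\<lambda>i. Y i x) [0..<n]"

lemma joint_eq_iff: "joint Y n x = joint Y n y \<longleftrightarrow> (\<forall>i<n. Y i x = Y i y)"
  by (auto simp: joint_def)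

lemma fibre_joint: "fibre M (joint Y n) (joint Y n x) = {y \<in> space M. \<forall>i<n. Y i y = Y i x}"
  by (auto simp: fibre_def joint_eq_iff)

text \<open>Lists over a countable type are again countable, so one label type serves every length
  \<open>n\<close>.\<close>

lemma labelling_joint:
  fixes Y :: "nat \<Rightarrow> 'a \<Rightarrow> 'b::countable"
  assumes "\<And>i. i < n \<Longrightarrow> labelling M (Y i)"
  shows "labelling M (joint Y n)"
  using assms
proof (induction n)
  case 0
  show ?case by (simp add: joint_def[abs_def])
next
  case (Suc n)
  have "labelling M (\<lambda>x. (joint Y n x, Y n x))"
    using Suc by (intro labelling_Pair) auto
  then show ?case
    by (rule labelling_factor) (auto simp: joint_eq_iff less_Suc_eq)
qed

context prob_space
begin

lemma label_entropy_const: "label_entropy M (\<lambda>_. c) = 0"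
proof -
  have "fibre M (\<lambda>_. c) c = space M" by (auto simp: fibre_def)
  then show ?thesis by (simp add: label_entropy_def prob_space)
qed

lemma label_entropy_joint_le:
  fixes Y :: "nat \<Rightarrow> 'a \<Rightarrow> 'b::countable"
  assumes "\<And>i. i < n \<Longrightarrow> labelling M (Y i)"
  shows "label_entropy M (joint Y n) \<le> (\<Sum>i<n. label_entropy M (Y i))"
  using assms
proof (induction n)
  case 0
  have "joint Y 0 = (\<lambda>_. [])" by (auto simp: joint_def)
  then show ?case by (simp add: label_entropy_const)
next
  case (Suc n)
  have lab: "labelling M (joint Y n)" "labelling M (Y n)"
    using Suc.prems by (auto intro: labelling_joint)
  have "label_entropy M (joint Y (Suc n)) \<le> label_entropy M (\<lambda>x. (joint Y n x, Y n x))"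
    using lab by (intro label_entropy_mono labelling_Pair) (auto simp: joint_eq_iff less_Suc_eq)
  also have "\<dots> \<le> label_entropy M (joint Y n) + label_entropy M (Y n)"
    by (rule label_entropy_Pair_le[OF lab])
  also have "\<dots> \<le> (\<Sum>i<Suc n. label_entropy M (Y i))"
    using Suc by (simp add: add_right_mono)
  finally show ?case .
qed

text \<open>\<open>- ln\<close> turns the product of probabilities into a sum wherever all factors
  are positive, hence almost everywhere.\<close>

lemma label_entropy_joint_indep:
  fixes Y :: "nat \<Rightarrow> 'a \<Rightarrow> 'b::countable"
  assumes Y: "\<And>i. i < n \<Longrightarrow> labelling M (Y i)"
    and indep: "\<And>x. x \<in> space M \<Longrightarrow>
      prob (fibre M (joint Y n) (joint Y n x)) = (\<Prod>i<n. prob (fibre M (Y i) (Y i x)))"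
  shows "label_entropy M (joint Y n) = (\<Sum>i<n. label_entropy M (Y i))"
proof -
  have "label_entropy M (joint Y n) = (\<integral>\<^sup>+x. (\<Sum>i<n. ennreal (- ln (prob (fibre M (Y i) (Y i x))))) \<partial>M)"
    unfolding label_entropy_def
  proof (rule nn_integral_cong_AE)
    have "AE x in M. \<forall>i\<in>{..<n}. 0 < prob (fibre M (Y i) (Y i x))"
      using Y by (intro AE_finite_allI AE_fibre_pos) auto
    with AE_space show "AE x in M. ennreal (- ln (prob (fibre M (joint Y n) (joint Y n x)))) =
        (\<Sum>i<n. ennreal (- ln (prob (fibre M (Y i) (Y i x)))))"
    proof eventually_elim
      case (elim x)
      have "- ln (prob (fibre M (joint Y n) (joint Y n x))) = (\<Sum>i<n. - ln (prob (fibre M (Y i) (Y i x))))"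
        using elim by (subst indep) (auto simp: sum_negf less_imp_neq[THEN not_sym] intro!: ln_prod)
      then show ?case
        using elim by (simp only:) (subst sum_ennreal, auto)
    qed
  qed
  also have "\<dots> = (\<Sum>i<n. label_entropy M (Y i))"
    unfolding label_entropy_def
    by (rule nn_integral_sum) (rule borel_measurable_labelling[OF Y], simp)
  finally show ?thesis .
qed

end

text \<open>The limit is the infimum \<open>L\<close> of the quotients with
  \<open>n \<ge> 1\<close>. Take \<open>m\<close> nearly attaining it and divide \<open>n\<close> by
  \<open>m\<close>: the \<open>q\<close> full blocks cost at most \<open>q * a m\<close>, and the
  remainder term stays bounded as \<open>n\<close> grows.\<close>

lemma fekete:
  fixes a :: "nat \<Rightarrow> real"
  assumes nonneg: "\<And>n. 0 \<le> a n" and sub: "\<And>m n. a (m + n) \<le> a m + a n"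
  shows "convergent (\<lambda>n. a n / real n)"
proof -
  define L where "L = (INF n\<in>{1..}. a n / real n)"
  have bdd: "bdd_below ((\<lambda>n. a n / real n) ` {1..})"
    using nonneg by (intro bdd_belowI2[of _ 0]) auto
  have lower: "L \<le> a n / real n" if "n \<ge> 1" for n
    unfolding L_def using that bdd by (intro cINF_lower) auto
  \<comment> \<open>The case \<open>q = 0\<close> is left out because subadditivity does not make
    \<open>a 0\<close> vanish.\<close>
  have mult: "a (q * m) \<le> real q * a m" if "q \<ge> 1" for q m
    using that
  proof (induction q rule: dec_induct)
    case (step q)
    then show ?case using sub[of m "q * m"] by (simp add: algebra_simps)
  qed simp
  have "(\<lambda>n. a n / real n) \<longlonglongrightarrow> L"
  proof (rule LIMSEQ_I)
    fix e :: real assume e: "0 < e"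
    obtain m where m: "m \<ge> 1" "a m / real m < L + e / 2"
      using cINF_less_iff[OF _ bdd, of "L + e / 2"] e unfolding L_def by fastforce
    \<comment> \<open>A bound for all remainders modulo \<open>m\<close> at once; \<open>N\<close>
      below makes its share smaller than \<open>e / 2\<close>.\<close>
    define C where "C = (\<Sum>r<m. a r)"
    have C: "a r \<le> C" if "r < m" for r
      unfolding C_def using that nonneg by (intro member_le_sum) auto
    obtain N where N: "real N > 2 * C / e" using reals_Archimedean2 by blast
    show "\<exists>no. \<forall>n\<ge>no. norm (a n / real n - L) < e"
    proof (intro exI allI impI)
      fix n assume n: "n \<ge> max (max N m) 1"
      define q where "q = n div m"
      have q: "q \<ge> 1" using n m by (simp add: q_def div_greater_zero_iff Suc_le_eq)
      have eq: "n = q * m + n mod m" by (simp add: q_def)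
      have "a n \<le> a (q * m) + a (n mod m)" using sub[of "q * m" "n mod m"] eq by simp
      also have "\<dots> \<le> real q * a m + C"
        using mult[OF q, of m] C[of "n mod m"] m by simp
      also have "real q * a m = (real q * real m) * (a m / real m)" using m by simp
      also have "\<dots> \<le> real n * (a m / real m)"
      proof (rule mult_right_mono)
        have "q * m \<le> n" using eq by simp
        then show "real q * real m \<le> real n" by (metis of_nat_le_iff of_nat_mult)
      qed (use nonneg in simp)
      finally have "a n / real n \<le> a m / real m + C / real n"
        using n by (simp add: field_simps)
      moreover have "C / real n < e / 2"
      proof -
        have "2 * C / e < real n" using N n by (simp add: less_le_trans)
        then show ?thesis using e n by (simp add: field_simps)
      qed
      moreover have "L \<le> a n / real n" using n by (intro lower) simp
      ultimately show "norm (a n / real n - L) < e" using m(2) unfolding real_norm_def by linarith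
    qed
  qed
  then show ?thesis by (rule convergentI)
qed

section \<open>Measure-preserving maps and itineraries\<close>

locale measure_preserving_map = prob_space +
  fixes f :: "'a \<Rightarrow> 'a"
  assumes measurable_map: "f \<in> measurable M M" and distr_map: "distr M M f = M"
begin

lemma measurable_iterate: "f ^^ i \<in> measurable M M"
  using measurable_map by (rule measurable_compose_n)

lemma distr_iterate: "distr M M (f ^^ i) = M"
proof (induction i)
  case 0
  then show ?case by (simp add: id_def distr_id)
next
  case (Suc i)
  have "distr M M (f ^^ Suc i) = distr (distr M M (f ^^ i)) M f"
    using measurable_map measurable_iterate by (subst distr_distr) simp_all
  then show ?case using Suc distr_map by (simp add: o_def)
qed

text \<open>The fibres of the shifted label are preimages under the iterate, so invariance keeps
  their probabilities; a second use of invariance moves the integral.\<close>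

lemma label_entropy_iterate:
  assumes X: "labelling M X"
  shows "label_entropy M (\<lambda>x. X ((f ^^ i) x)) = label_entropy M X"
proof -
  have "prob (fibre M (\<lambda>x. X ((f ^^ i) x)) a) = prob (fibre M X a)" for a
  proof -
    have "prob (fibre M X a) = measure (distr M M (f ^^ i)) (fibre M X a)"
      by (simp add: distr_iterate)
    also have "\<dots> = prob ((f ^^ i) -` fibre M X a \<inter> space M)"
      using sets_fibre[OF X] measurable_iterate by (intro measure_distr) auto
    also have "(f ^^ i) -` fibre M X a \<inter> space M = fibre M (\<lambda>x. X ((f ^^ i) x)) a"
      using measurable_space[OF measurable_iterate] by (auto simp: fibre_def)
    finally show ?thesis ..
  qed
  moreover have "label_entropy M X = (\<integral>\<^sup>+x. ennreal (- ln (prob (fibre M X (X x)))) \<partial>distr M M (f ^^ i))"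
    by (simp add: label_entropy_def distr_iterate)
  moreover have "\<dots> = (\<integral>\<^sup>+x. ennreal (- ln (prob (fibre M X (X ((f ^^ i) x))))) \<partial>M)"
    by (rule nn_integral_distr[OF measurable_iterate]) (simp, rule borel_measurable_labelling[OF X])
  ultimately show ?thesis by (simp add: label_entropy_def)
qed

definition itinerary :: "('a \<Rightarrow> 'b) \<Rightarrow> nat \<Rightarrow> 'a \<Rightarrow> 'b list" where
  "itinerary X = joint (\<lambda>i x. X ((f ^^ i) x))"

lemma itinerary_eq_iff: "itinerary X n x = itinerary X n y \<longleftrightarrow> (\<forall>i<n. X ((f ^^ i) x) = X ((f ^^ i) y))"
  by (simp add: itinerary_def joint_eq_iff)

lemma labelling_iterate: "labelling M X \<Longrightarrow> labelling M (\<lambda>x. X ((f ^^ i) x))"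
  by (rule measurable_compose[OF measurable_iterate])

lemma labelling_itinerary: "labelling M X \<Longrightarrow> labelling M (itinerary X n)"
  unfolding itinerary_def by (intro labelling_joint labelling_iterate)

lemma label_entropy_itinerary_le:
  "labelling M X \<Longrightarrow> label_entropy M (itinerary X n) \<le> of_nat n * label_entropy M X"
  using label_entropy_joint_le[of n "\<lambda>i x. X ((f ^^ i) x)", OF labelling_iterate]
  by (simp add: itinerary_def label_entropy_iterate)

text \<open>Cutting an itinerary at time \<open>m\<close> leaves the \<open>n\<close>-itinerary of
  \<open>(f ^^ m) x\<close>, which has the same entropy by invariance. This is the subadditivity
  that \<open>fekete\<close> asks for.\<close>

lemma label_entropy_itinerary_add:
  assumes X: "labelling M X"
  shows "label_entropy M (itinerary X (m + n)) \<le> label_entropy M (itinerary X m) + label_entropy M (itinerary X n)"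
proof -
  have lab: "labelling M (itinerary X m)" "labelling M (\<lambda>x. itinerary X n ((f ^^ m) x))"
    using X by (auto intro: labelling_itinerary labelling_iterate)
  have "label_entropy M (itinerary X (m + n)) \<le>
      label_entropy M (\<lambda>x. (itinerary X m x, itinerary X n ((f ^^ m) x)))"
  proof (rule label_entropy_mono[OF labelling_Pair[OF lab]])
    fix x y assume "(itinerary X m x, itinerary X n ((f ^^ m) x)) = (itinerary X m y, itinerary X n ((f ^^ m) y))"
    then have eq: "\<And>i. i < m \<Longrightarrow> X ((f ^^ i) x) = X ((f ^^ i) y)"
      "\<And>i. i < n \<Longrightarrow> X ((f ^^ (i + m)) x) = X ((f ^^ (i + m)) y)"
      by (simp_all add: itinerary_eq_iff funpow_add)
    have "X ((f ^^ i) x) = X ((f ^^ i) y)" if "i < m + n" for i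
      using that eq(1)[of i] eq(2)[of "i - m"] by (cases "i < m") auto
    then show "itinerary X (m + n) x = itinerary X (m + n) y"
      by (simp add: itinerary_eq_iff)
  qed
  also have "\<dots> \<le> label_entropy M (itinerary X m) + label_entropy M (itinerary X n)"
    using label_entropy_Pair_le[OF lab] label_entropy_iterate[OF labelling_itinerary[OF X]] by simp
  finally show ?thesis .
qed

lemma label_entropy_itinerary_finite:
  assumes "labelling M X" "label_entropy M X < \<infinity>"
  shows "label_entropy M (itinerary X n) < \<infinity>"
  using label_entropy_itinerary_le[OF assms(1), of n] assms(2)
  by (auto simp: ennreal_mult_less_top less_top[symmetric] top_unique ennreal_mult_eq_top_iff)

text \<open>Finiteness of the entropy passes to all itineraries, so their entropies form a real
  sequence to which \<open>fekete\<close> applies.\<close>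

lemma convergent_entropy_rate:
  assumes X: "labelling M X" "label_entropy M X < \<infinity>"
  shows "convergent (\<lambda>n. label_entropy M (itinerary X n) / of_nat n)"
proof -
  define a where "a n = enn2real (label_entropy M (itinerary X n))" for n
  have nonneg: "0 \<le> a n" for n by (simp add: a_def)
  have a: "label_entropy M (itinerary X n) = ennreal (a n)" for n
    using label_entropy_itinerary_finite[OF X, of n] by (simp add: a_def)
  have "convergent (\<lambda>n. a n / real n)"
  proof (rule fekete)
    show "0 \<le> a n" for n by (rule nonneg)
    then show "a (m + n) \<le> a m + a n" for m n
      using label_entropy_itinerary_add[OF X(1), of m n] by (simp add: a flip: ennreal_plus)
  qed
  then obtain L where "(\<lambda>n. a n / real n) \<longlonglongrightarrow> L" by (auto simp: convergent_def)
  then have "(\<lambda>n. ennreal (a n / real n)) \<longlonglongrightarrow> ennreal L" by (rule tendsto_ennrealI)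
  moreover have "\<forall>\<^sub>F n in sequentially. ennreal (a n / real n) = label_entropy M (itinerary X n) / of_nat n"
    using eventually_gt_at_top[of 0]
    by eventually_elim (simp add: a nonneg divide_ennreal ennreal_of_nat_eq_real_of_nat)
  ultimately show ?thesis
    by (auto simp: convergent_def dest: Lim_transform_eventually)
qed

text \<open>A block of the refinement is a nonempty intersection of one chosen block per pullback,
  and any of its points determines all the choices. With no pullbacks the refinement would be
  \<open>{UNIV}\<close> instead of \<open>{space M}\<close>.\<close>

lemma iterated_partition_fibre_partition:
  assumes "0 < n"
  shows "iterated_partition M f (fibre_partition M X) n = fibre_partition M (itinerary X n)"
proof -
  let ?Y = "\<lambda>i x. X ((f ^^ i) x)"
  \<comment> \<open>Indexed by the values of \<open>X\<close>, not of \<open>?Y i\<close>: a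
    pullback contains an empty block when \<open>f ^^ i\<close> misses a fibre.\<close>
  let ?P = "\<lambda>i. fibre M (?Y i) ` (X ` space M)"
  have pull: "pullback_partition M (f ^^ i) (fibre_partition M X) = ?P i" for i
    using measurable_space[OF measurable_iterate]
    by (auto simp: pullback_partition_def fibre_partition_def image_image fibre_def intro!: image_cong)
  have in_space: "(f ^^ i) x \<in> space M" if "x \<in> space M" for i x
    using measurable_space[OF measurable_iterate that] .
  have uniq: "B = fibre M (?Y i) (?Y i x)" if "B \<in> ?P i" "x \<in> B" for B i x
    using that by (auto simp: fibre_def)
  have mem: "fibre M (?Y i) (?Y i x) \<in> ?P i" "x \<in> fibre M (?Y i) (?Y i x)" if "x \<in> space M" for i x
    using in_space[OF that] that by (auto simp: fibre_def)
  have Int: "(\<Inter>i<n. fibre M (?Y i) (?Y i x)) = fibre M (itinerary X n) (itinerary X n x)" for x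
    unfolding itinerary_def fibre_joint using assms by (auto simp: fibre_def)
  show ?thesis
  proof (intro set_eqI iffI)
    fix A assume "A \<in> iterated_partition M f (fibre_partition M X) n"
    then obtain F where F: "\<And>i. i < n \<Longrightarrow> F (?P i) \<in> ?P i" "A = (\<Inter>i<n. F (?P i))" and "A \<noteq> {}"
      unfolding iterated_partition_def pull common_refinement by (auto simp: image_image)
    then obtain x where x: "x \<in> A" by auto
    have "F (?P i) = fibre M (?Y i) (?Y i x)" if "i < n" for i
      using F x that by (intro uniq) auto
    then have "A = fibre M (itinerary X n) (itinerary X n x)"
      using F(2) Int by simp
    moreover have "x \<in> space M"
    proof -
      have "x \<in> F (?P 0)" using x assms unfolding F(2) by blast
      then show ?thesis using F(1)[OF assms] by (auto simp: fibre_def)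
    qed
    ultimately show "A \<in> fibre_partition M (itinerary X n)"
      by (auto simp: fibre_partition_def)
  next
    fix A assume "A \<in> fibre_partition M (itinerary X n)"
    then obtain x where x: "x \<in> space M" and A: "A = fibre M (itinerary X n) (itinerary X n x)"
      by (auto simp: fibre_partition_def)
    \<comment> \<open>The choice function takes a partition, not a time, since
      \<open>common_refinement\<close> ranges over a set in which equal pullbacks coincide.\<close>
    define F where "F P = (SOME B. B \<in> P \<and> x \<in> B)" for P
    have F: "F (?P i) \<in> ?P i \<and> x \<in> F (?P i)" for i
      unfolding F_def by (rule someI) (use mem[OF x] in blast)
    then have "F (?P i) = fibre M (?Y i) (?Y i x)" for i
      by (intro uniq) auto
    then have "A = (\<Inter>i<n. F (?P i))" using A Int by simp
    moreover have "A \<noteq> {}" using x A by (auto simp: fibre_def)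
    ultimately show "A \<in> iterated_partition M f (fibre_partition M X) n"
      unfolding iterated_partition_def pull common_refinement using F
      by (auto simp: image_image intro!: bexI[of _ F])
  qed
qed

lemma entropy_rate_eq:
  assumes X: "labelling M X"
  shows "lim (\<lambda>n. partition_entropy M (iterated_partition M f (fibre_partition M X) n) / of_nat n)
    = lim (\<lambda>n. label_entropy M (itinerary X n) / of_nat n)"
proof -
  have "\<forall>\<^sub>F n in sequentially.
      partition_entropy M (iterated_partition M f (fibre_partition M X) n) / of_nat n
        = label_entropy M (itinerary X n) / of_nat n"
    using eventually_gt_at_top[of 0]
    by eventually_elim
      (simp add: iterated_partition_fibre_partition partition_entropy_fibre_partition labelling_itinerary X)
  then show ?thesis unfolding lim_def by (simp add: tendsto_cong)
qed

end

text \<open>Numbering the blocks by \<open>to_nat_on P\<close> reduces the supremum in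
  \<open>ks_entropy\<close> to labels in \<open>nat\<close>, which can be truncated at a level
  \<open>K\<close>.\<close>

lemma countable_partition_imp_labelling:
  assumes "countable_partition M P"
  obtains X :: "'a \<Rightarrow> nat" where "labelling M X" "P = fibre_partition M X"
proof -
  have P: "countable P" "P \<subseteq> sets M" "partition_on (space M) P"
    using assms by (auto simp: countable_partition_def)
  have ex: "\<exists>!A. A \<in> P \<and> x \<in> A" if "x \<in> space M" for x
  proof -
    have "x \<in> \<Union>P" using partition_onD1[OF P(3)] that by simp
    then obtain A where A: "A \<in> P" "x \<in> A" by (rule UnionE)
    show ?thesis
    proof (rule ex1I)
      show "A \<in> P \<and> x \<in> A" using A by simp
      fix B assume B: "B \<in> P \<and> x \<in> B"
      show "B = A"
      proof (rule ccontr)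
        assume "B \<noteq> A"
        then have "B \<inter> A = {}" using B A disjointD[OF partition_onD2[OF P(3)]] by simp
        then show False using A B by auto
      qed
    qed
  qed
  define c where "c x = (THE A. A \<in> P \<and> x \<in> A)" for x
  have c: "c x \<in> P" "x \<in> c x" if "x \<in> space M" for x
    using theI'[OF ex[OF that]] by (auto simp: c_def)
  have sub: "A \<subseteq> space M" if "A \<in> P" for A using P(3) that by (auto simp: partition_on_def)
  have c_eq: "c x = A" if "x \<in> A" "A \<in> P" for x A
    using that ex[of x] c[of x] sub by blast
  define X where "X x = to_nat_on P (c x)" for x
  have inj: "inj_on (to_nat_on P) P" by (rule inj_on_to_nat_on[OF P(1)])
  have fib: "fibre M X (to_nat_on P A) = A" if "A \<in> P" for A
  proof (intro equalityI subsetI)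
    fix x assume "x \<in> fibre M X (to_nat_on P A)"
    then have x: "x \<in> space M" "to_nat_on P (c x) = to_nat_on P A" by (auto simp: fibre_def X_def)
    then have "c x = A" using inj_onD[OF inj] c(1) that by blast
    then show "x \<in> A" using c(2) x by blast
  next
    fix x assume "x \<in> A"
    then show "x \<in> fibre M X (to_nat_on P A)" using c_eq that sub by (auto simp: fibre_def X_def)
  qed
  have fib': "fibre M X n = {}" if "n \<notin> to_nat_on P ` P" for n
    using that c unfolding fibre_def X_def by auto
  show thesis
  proof
    show "labelling M X"
      unfolding labelling_iff proof
      fix n show "fibre M X n \<in> sets M"
        using fib fib'[of n] P(2) by (cases "n \<in> to_nat_on P ` P") auto
    qed
    have "X ` space M = to_nat_on P ` P"
    proof -
      have "c ` space M = P"
      proof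
        show "c ` space M \<subseteq> P" using c by auto
        show "P \<subseteq> c ` space M"
        proof
          fix A assume "A \<in> P"
          \<comment> \<open>No block of a partition is empty, so every block number is
            attained.\<close>
          then obtain x where "x \<in> A" using partition_onD3[OF P(3)] by fastforce
          then show "A \<in> c ` space M" using \<open>A \<in> P\<close> c_eq sub by blast
        qed
      qed
      moreover have "X = to_nat_on P \<circ> c" by (auto simp: X_def)
      ultimately show ?thesis by (metis image_comp)
    qed
    then show "P = fibre_partition M X"
      unfolding fibre_partition_def using fib by (simp add: image_image)
  qed
qed

section \<open>Entropy rates and approximation\<close>

text \<open>\<open>ln y \<le> y - 1\<close> at \<open>y = 1 / sqrt p\<close>. Meant for small
  blocks: unlike \<open>- p * ln p\<close>, the bound is increasing on all of [0, 1], and it tends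
  to 0 with \<open>p\<close>.\<close>

lemma entropy_term_le_sqrt: "- p * ln p \<le> 2 * sqrt p" if "0 \<le> p" for p :: real
proof (cases "p = 0")
  case False
  then have p: "0 < p" using that by simp
  have "ln (1 / sqrt p) \<le> 1 / sqrt p - 1" using p by (intro ln_le_minus_one) simp
  then have "- ln p \<le> 2 / sqrt p" using p by (simp add: ln_div ln_sqrt)
  then have "p * - ln p \<le> p * (2 / sqrt p)" using p by (intro mult_left_mono) auto
  also have "\<dots> = 2 * sqrt p" using p by (simp add: field_simps)
  finally show ?thesis by simp
qed simp

text \<open>The counterpart for a block of probability near 1, from
  \<open>y = 1 / p\<close>.\<close>

lemma entropy_term_le: "- p * ln p \<le> 1 - p" if "0 \<le> p" for p :: real
proof (cases "p = 0")
  case False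
  then have p: "0 < p" using that by simp
  have "ln (1 / p) \<le> 1 / p - 1" using p by (intro ln_le_minus_one) simp
  then have "p * - ln p \<le> p * (1 / p - 1)" using p by (intro mult_left_mono) (auto simp: ln_div)
  then show ?thesis using p by (simp add: algebra_simps)
qed simp

context prob_space
begin

text \<open>For a label that rarely leaves its default value \<open>c\<close>: the block of
  \<open>c\<close> costs at most the probability of leaving, every other block at most
  \<open>2 * sqrt d\<close>. With \<open>S\<close> fixed this tends to 0 with
  \<open>d\<close>.\<close>

lemma label_entropy_finite_le:
  fixes V :: "'a \<Rightarrow> 'b::countable"
  assumes V: "labelling M V" and S: "finite S" "V ` space M \<subseteq> insert c S" "c \<notin> S"
    and d: "prob {x \<in> space M. V x \<noteq> c} \<le> d"
  shows "label_entropy M V \<le> ennreal (d + real (card S) * (2 * sqrt d))"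
proof -
  let ?p = "\<lambda>a. prob (fibre M V a)"
  let ?t = "\<lambda>a. - ?p a * ln (?p a)"
  have compl: "space M - fibre M V c = {x \<in> space M. V x \<noteq> c}" by (auto simp: fibre_def)
  have meas: "{x \<in> space M. V x \<noteq> c} \<in> sets M"
    unfolding compl[symmetric] using sets_fibre[OF V] by auto
  have nonneg: "0 \<le> ?t a" for a
    by (cases "?p a = 0") (auto simp: zero_less_measure_iff mult_nonneg_nonpos)
  have "fibre M V a = {}" if "a \<notin> insert c S" for a
    using that S(2) by (auto simp: fibre_def)
  then have "label_entropy M V = (\<Sum>a\<in>insert c S. ennreal (?t a))"
    unfolding label_entropy_count_space[OF V] using S(1) by (intro nn_integral_count_space') auto
  also have "\<dots> = ennreal (?t c + (\<Sum>a\<in>S. ?t a))"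
    using S nonneg by (subst sum_ennreal) auto
  also have "\<dots> \<le> ennreal (d + real (card S) * (2 * sqrt d))"
  proof (intro ennreal_leI add_mono)
    have "?t c \<le> 1 - ?p c" by (rule entropy_term_le) simp
    also have "\<dots> = prob (space M - fibre M V c)" using sets_fibre[OF V] by (simp add: prob_compl)
    finally show "?t c \<le> d" using d compl by simp
    show "(\<Sum>a\<in>S. ?t a) \<le> real (card S) * (2 * sqrt d)"
    proof (rule sum_bounded_above)
      fix a assume a: "a \<in> S"
      have "?p a \<le> prob {x \<in> space M. V x \<noteq> c}"
        using a S(3) meas by (intro finite_measure_mono) (auto simp: fibre_def)
      then have "sqrt (?p a) \<le> sqrt d" using d by simp
      then show "?t a \<le> 2 * sqrt d"
        using entropy_term_le_sqrt[of "?p a", OF measure_nonneg] by linarith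
    qed
  qed
  finally show ?thesis .
qed

text \<open>Lumping all values below \<open>K\<close> into \<open>None\<close> leaves a tail of the
  convergent entropy series and the term of one block whose probability is near 1. Each gets half of
  \<open>e\<close>.\<close>

lemma label_entropy_tail:
  fixes X :: "'a \<Rightarrow> nat"
  assumes X: "labelling M X" "label_entropy M X < \<infinity>" and e: "0 < e"
  obtains K where "label_entropy M (\<lambda>x. if K \<le> X x then Some (X x) else None) \<le> ennreal e"
proof -
  let ?p = "\<lambda>k. prob (fibre M X k)"
  define t where "t k = - ?p k * ln (?p k)" for k
  have nonneg: "0 \<le> t k" for k unfolding t_def
    by (cases "?p k = 0") (auto simp: zero_less_measure_iff mult_nonneg_nonpos)
  have "(\<Sum>k. ennreal (t k)) < \<infinity>"
    using X(2) unfolding label_entropy_count_space[OF X(1)] nn_integral_count_space_nat t_def .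
  then have summ: "summable t"
    using nonneg by (intro summable_suminf_not_top) auto
  have ge: "{x \<in> space M. K \<le> X x} = space M - (\<Union>k<K. fibre M X k)" for K
    by (auto simp: fibre_def)
  have meas: "{x \<in> space M. K \<le> X x} \<in> sets M" for K
    unfolding ge using sets_fibre[OF X(1)] by auto
  have "(\<lambda>K. prob {x \<in> space M. K \<le> X x}) \<longlonglongrightarrow> prob (\<Inter>K. {x \<in> space M. K \<le> X x})"
    using meas by (intro finite_Lim_measure_decseq) (auto simp: decseq_def)
  moreover have "(\<Inter>K. {x \<in> space M. K \<le> X x}) = {}"
    using not_less_eq_eq by auto
  ultimately have "(\<lambda>K. prob {x \<in> space M. K \<le> X x}) \<longlonglongrightarrow> 0" by simp
  then have "\<forall>\<^sub>F K in sequentially. prob {x \<in> space M. K \<le> X x} < e / 2"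
    using e by (intro order_tendstoD) auto
  moreover have "\<exists>N. \<forall>n\<ge>N. norm (\<Sum>i. t (i + n)) < e / 2"
    using suminf_exist_split[OF _ summ, of "e / 2"] e by simp
  then have "\<forall>\<^sub>F K in sequentially. norm (\<Sum>i. t (i + K)) < e / 2"
    by (simp add: eventually_sequentially)
  ultimately obtain K where K: "prob {x \<in> space M. K \<le> X x} < e / 2" "norm (\<Sum>i. t (i + K)) < e / 2"
    using eventually_happens'[OF sequentially_bot eventually_conj] by blast
  let ?Z = "\<lambda>x. if K \<le> X x then Some (X x) else None"
  let ?B = "{x \<in> space M. \<not> K \<le> X x}"
  have B: "?B = space M - {x \<in> space M. K \<le> X x}" by auto
  have measB: "?B \<in> sets M" unfolding B using meas by auto
  let ?h = "\<lambda>k. if K \<le> k then ennreal (- ln (?p k)) else 0"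
  let ?c = "ennreal (- ln (prob ?B))"
  have fib: "fibre M ?Z (Some k) = fibre M X k" if "K \<le> k" for k
    using that by (auto simp: fibre_def split: if_splits)
  have fibN: "fibre M ?Z None = ?B" by (auto simp: fibre_def split: if_splits)
  have "label_entropy M ?Z = (\<integral>\<^sup>+x. ?h (X x) + ?c * indicator ?B x \<partial>M)"
    unfolding label_entropy_def
    by (intro nn_integral_cong) (auto simp: fib fibN split: split_indicator)
  also have "\<dots> = (\<integral>\<^sup>+x. ?h (X x) \<partial>M) + ?c * emeasure M ?B"
    using measB borel_measurable_labelling[OF X(1), of ?h]
    by (subst nn_integral_add) (auto simp: nn_integral_cmult_indicator)
  also have "?c * emeasure M ?B \<le> ennreal (e / 2)"
  proof -
    have "ln (prob ?B) \<le> 0"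
      by (cases "prob ?B = 0") (auto simp: zero_less_measure_iff)
    then have "?c * emeasure M ?B = ennreal (- prob ?B * ln (prob ?B))"
      by (simp add: emeasure_eq_measure ennreal_mult''[symmetric] mult.commute)
    moreover have "- prob ?B * ln (prob ?B) \<le> 1 - prob ?B" by (rule entropy_term_le) simp
    moreover have "prob ?B = 1 - prob {x \<in> space M. K \<le> X x}"
      unfolding B using meas by (rule prob_compl)
    ultimately show ?thesis using K(1) by (simp add: ennreal_leI)
  qed
  also have "(\<integral>\<^sup>+x. ?h (X x) \<partial>M) = (\<Sum>k. ?h k * emeasure M (fibre M X k))"
    unfolding nn_integral_labelling[OF X(1), of ?h] nn_integral_count_space_nat ..
  \<comment> \<open>\<open>?h\<close> vanishes below \<open>K\<close>, so shifting the index loses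
    nothing.\<close>
  also have "\<dots> = (\<Sum>k. ?h (k + K) * emeasure M (fibre M X (k + K)))"
    by (subst suminf_offset[where i = K]) (auto intro: summableI)
  also have "\<dots> = (\<Sum>k. ennreal (t (k + K)))"
  proof (rule suminf_cong)
    fix k
    have "ln (?p (k + K)) \<le> 0"
      by (cases "?p (k + K) = 0") (auto simp: zero_less_measure_iff)
    then show "?h (k + K) * emeasure M (fibre M X (k + K)) = ennreal (t (k + K))"
      by (simp add: t_def emeasure_eq_measure ennreal_mult''[symmetric] mult.commute)
  qed
  also have "\<dots> = ennreal (\<Sum>k. t (k + K))"
    using nonneg summ by (intro suminf_ennreal2) (auto intro: summable_ignore_initial_segment)
  also have "\<dots> \<le> ennreal (e / 2)"
    using K(2) by (intro ennreal_leI) simp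
  finally have "label_entropy M ?Z \<le> ennreal (e / 2) + ennreal (e / 2)"
    by (simp add: add_right_mono)
  also have "\<dots> = ennreal e" using e by (simp flip: ennreal_plus)
  finally show thesis by (rule that)
qed

end

context measure_preserving_map
begin

text \<open>Takes the place of a conditional entropy bound: \<open>X'\<close> enters through its
  joint itinerary, whereas each error label is charged its full entropy at every time.\<close>

lemma label_entropy_itinerary_triple:
  fixes X :: "'a \<Rightarrow> 'b::countable" and X' :: "'a \<Rightarrow> 'c::countable"
    and Z :: "'a \<Rightarrow> 'd::countable" and V :: "'a \<Rightarrow> 'e::countable"
  assumes lab: "labelling M X'" "labelling M Z" "labelling M V"
    and det: "\<And>x y. x \<in> space M \<Longrightarrow> y \<in> space M \<Longrightarrow> X' x = X' y \<Longrightarrow> Z x = Z y \<Longrightarrow> V x = V y \<Longrightarrow> X x = X y"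
  shows "label_entropy M (itinerary X n)
    \<le> label_entropy M (itinerary X' n) + of_nat n * (label_entropy M Z + label_entropy M V)"
proof -
  have it: "labelling M (itinerary X' n)" "labelling M (itinerary Z n)" "labelling M (itinerary V n)"
    by (rule labelling_itinerary, fact)+
  have "label_entropy M (itinerary X n)
      \<le> label_entropy M (\<lambda>x. (itinerary X' n x, (itinerary Z n x, itinerary V n x)))"
  proof (rule label_entropy_mono)
    fix x y assume xy: "x \<in> space M" "y \<in> space M"
      and eq: "(itinerary X' n x, (itinerary Z n x, itinerary V n x)) = (itinerary X' n y, (itinerary Z n y, itinerary V n y))"
    have "X ((f ^^ i) x) = X ((f ^^ i) y)" if "i < n" for i
      using eq that xy by (intro det measurable_space[OF measurable_iterate]) (auto simp: itinerary_eq_iff)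
    then show "itinerary X n x = itinerary X n y" by (simp add: itinerary_eq_iff)
  qed (intro labelling_Pair it)
  also have "\<dots> \<le> label_entropy M (itinerary X' n) + label_entropy M (\<lambda>x. (itinerary Z n x, itinerary V n x))"
    by (intro label_entropy_Pair_le labelling_Pair it)
  also have "label_entropy M (\<lambda>x. (itinerary Z n x, itinerary V n x))
      \<le> label_entropy M (itinerary Z n) + label_entropy M (itinerary V n)"
    by (intro label_entropy_Pair_le it)
  also have "\<dots> \<le> of_nat n * label_entropy M Z + of_nat n * label_entropy M V"
    by (intro add_mono label_entropy_itinerary_le lab)
  finally show ?thesis by (simp add: distrib_left add_left_mono)
qed

text \<open>The error of the approximation \<open>X'\<close> is carried by two labels: the large values of \<open>X\<close>, and
  the small values at which \<open>X\<close> and \<open>X'\<close> differ. Both have small entropy.\<close>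

lemma entropy_rate_le:
  fixes X :: "'a \<Rightarrow> nat"
  assumes X: "labelling M X" "label_entropy M X < \<infinity>" and h: "0 \<le> h"
    and approx: "\<And>K d. 0 < d \<Longrightarrow> \<exists>X' :: 'a \<Rightarrow> nat. \<exists>C. labelling M X' \<and>
      prob {x \<in> space M. X x < K \<and> X x \<noteq> X' x} \<le> d \<and> 0 \<le> C \<and>
      (\<forall>n\<ge>1. label_entropy M (itinerary X' n) \<le> ennreal (C + real n * h))"
  shows "lim (\<lambda>n. label_entropy M (itinerary X n) / of_nat n) \<le> ennreal h"
proof (rule ennreal_le_epsilon)
  fix e :: real assume e: "0 < e"
  obtain K where K: "label_entropy M (\<lambda>x. if K \<le> X x then Some (X x) else None) \<le> ennreal (e / 2)"
    using label_entropy_tail[OF X, of "e / 2"] e by auto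
  \<comment> \<open>\<open>K\<close> is already fixed, so the cost of the mismatch label, which has
    at most \<open>K\<close> values besides \<open>None\<close>, can be made small by
    \<open>d\<close>.\<close>
  have "((\<lambda>d. d + real K * (2 * sqrt d)) \<longlongrightarrow> 0 + real K * (2 * sqrt 0)) (at_right 0)"
    by (intro tendsto_intros)
  then have "\<forall>\<^sub>F d in at_right 0. d + real K * (2 * sqrt d) < e / 2"
    using e by (intro order_tendstoD(2)) auto
  moreover have "\<forall>\<^sub>F d in at_right (0::real). 0 < d" by (rule eventually_at_right_less)
  ultimately obtain d where d: "0 < d" "d + real K * (2 * sqrt d) < e / 2"
    using eventually_happens'[OF trivial_limit_at_right_real eventually_conj] by blast
  obtain X' C where X': "labelling M X'" "prob {x \<in> space M. X x < K \<and> X x \<noteq> X' x} \<le> d" "0 \<le> C"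
      "\<And>n. n \<ge> 1 \<Longrightarrow> label_entropy M (itinerary X' n) \<le> ennreal (C + real n * h)"
    using approx[OF d(1), of K] by blast
  let ?Z = "\<lambda>x. if K \<le> X x then Some (X x) else None"
  let ?V = "\<lambda>x. if X x < K \<and> X x \<noteq> X' x then Some (X x) else None"
  have XX': "labelling M (\<lambda>x. (X x, X' x))" by (intro labelling_Pair X X')
  have Z: "labelling M ?Z" by (rule labelling_factor[OF XX']) auto
  have V: "labelling M ?V" by (rule labelling_factor[OF XX']) auto
  have "label_entropy M ?V \<le> ennreal (d + real (card (Some ` {..<K})) * (2 * sqrt d))"
  proof (rule label_entropy_finite_le[OF V])
    have "{x \<in> space M. ?V x \<noteq> None} = {x \<in> space M. X x < K \<and> X x \<noteq> X' x}" by auto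
    then show "prob {x \<in> space M. ?V x \<noteq> None} \<le> d" using X'(2) by simp
  qed auto
  also have "\<dots> \<le> ennreal (e / 2)"
    using d by (intro ennreal_leI) (simp add: card_image)
  finally have entV: "label_entropy M ?V \<le> ennreal (e / 2)" .
  have entZV: "label_entropy M ?Z + label_entropy M ?V \<le> ennreal e"
    using add_mono[OF K entV] e by (simp flip: ennreal_plus)
  have bound: "label_entropy M (itinerary X n) / of_nat n \<le> ennreal (C / real n + (h + e))" if n: "n \<ge> 1" for n
  proof -
    \<comment> \<open>\<open>X\<close> is read off \<open>?Z\<close> or \<open>?V\<close> when one
      of them is a \<open>Some\<close>, and equals \<open>X'\<close> otherwise.\<close>
    have "label_entropy M (itinerary X n)
        \<le> label_entropy M (itinerary X' n) + of_nat n * (label_entropy M ?Z + label_entropy M ?V)"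
      using X'(1) Z V by (rule label_entropy_itinerary_triple) (auto split: if_splits)
    also have "\<dots> \<le> ennreal (C + real n * h) + of_nat n * ennreal e"
      using n entZV X' by (intro add_mono mult_left_mono) auto
    also have "\<dots> = ennreal (C + real n * (h + e))"
      using h e X' by (simp add: ennreal_of_nat_eq_real_of_nat algebra_simps flip: ennreal_mult ennreal_plus)
    finally have "label_entropy M (itinerary X n) / of_nat n \<le> ennreal (C + real n * (h + e)) / ennreal (real n)"
      by (simp add: divide_right_mono_ennreal ennreal_of_nat_eq_real_of_nat)
    also have "\<dots> = ennreal (C / real n + (h + e))"
      using h e X'(3) n by (subst divide_ennreal) (auto simp: add_divide_distrib simp del: ennreal_plus)
    finally show ?thesis .
  qed
  have "(\<lambda>n. label_entropy M (itinerary X n) / of_nat n) \<longlonglongrightarrow> lim (\<lambda>n. label_entropy M (itinerary X n) / of_nat n)"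
    using convergent_entropy_rate[OF X] by (simp add: convergent_LIMSEQ_iff)
  moreover have "(\<lambda>n. ennreal (C / real n + (h + e))) \<longlonglongrightarrow> ennreal (0 + (h + e))"
    by (intro tendsto_intros lim_const_over_n)
  ultimately have "lim (\<lambda>n. label_entropy M (itinerary X n) / of_nat n) \<le> ennreal (0 + (h + e))"
    using bound by (intro LIMSEQ_le) auto
  then show "lim (\<lambda>n. label_entropy M (itinerary X n) / of_nat n) \<le> ennreal h + ennreal e"
    using h e by (simp flip: ennreal_plus)
qed

end

text \<open>The approximable sets form a sigma-algebra: complements have the same symmetric
  difference, and a countable union is first cut to finitely many members, which are then
  approximated one by one.\<close>

lemma (in prob_space) approx_by_algebra:
  assumes R: "algebra (space M) R" and gen: "sets M = sigma_sets (space M) R"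
    and A: "A \<in> sets M" and e: "0 < e"
  shows "\<exists>B\<in>R. prob (sym_diff A B) < e"
proof -
  interpret R: algebra "space M" R by (rule R)
  have RM: "B \<in> sets M" if "B \<in> R" for B using that gen by auto
  have "A \<in> sigma_sets (space M) R" using A gen by simp
  \<comment> \<open>Measurability travels with the induction because the probability estimates use
    it.\<close>
  then have "A \<in> sets M \<and> (\<forall>e>0. \<exists>B\<in>R. prob (sym_diff A B) < e)"
  proof induction
    case (Basic a)
    then show ?case using RM by (auto intro!: bexI[of _ a])
  next
    case Empty
    show ?case by (auto intro!: bexI[of _ "{}"])
  next
    case (Compl a)
    have "\<exists>B\<in>R. prob (sym_diff (space M - a) B) < e" if e: "0 < e" for e
    proof -
      obtain B where B: "B \<in> R" "prob (sym_diff a B) < e" using Compl.IH e by blast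
      have "sym_diff (space M - a) (space M - B) = sym_diff a B"
        using sets.sets_into_space[OF conjunct1[OF Compl.IH]] sets.sets_into_space[OF RM[OF B(1)]] by auto
      then show ?thesis using B R.compl_sets by (auto intro!: bexI[of _ "space M - B"])
    qed
    then show ?case using Compl.IH by auto
  next
    case (Union a)
    have a: "a i \<in> sets M" for i using Union.IH by blast
    have "\<exists>B\<in>R. prob (sym_diff (\<Union>i. a i) B) < e" if e: "0 < e" for e
    proof -
      let ?U = "\<lambda>n. \<Union>i<n. a i"
      have "(\<lambda>n. prob (?U n)) \<longlonglongrightarrow> prob (\<Union>n. ?U n)"
        using a by (intro finite_Lim_measure_incseq) (auto simp: incseq_def intro: less_le_trans)
      moreover have "(\<Union>n. ?U n) = (\<Union>i. a i)" by auto
      ultimately have "\<forall>\<^sub>F n in sequentially. prob (\<Union>i. a i) - e / 2 < prob (?U n)"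
        using e by (intro order_tendstoD) auto
      then obtain n where n: "prob (\<Union>i. a i) - e / 2 < prob (?U n)"
        using eventually_happens'[OF sequentially_bot] by blast
      \<comment> \<open>The \<open>n\<close> errors together stay within \<open>e / 2\<close>; the
        \<open>+ 1\<close> covers \<open>n = 0\<close>.\<close>
      have "\<forall>i. \<exists>B\<in>R. prob (sym_diff (a i) B) < e / (2 * (real n + 1))"
        using Union.IH e by simp
      then obtain B where B: "\<And>i. B i \<in> R" "\<And>i. prob (sym_diff (a i) (B i)) < e / (2 * (real n + 1))"
        by metis
      have BM: "B i \<in> sets M" for i using B RM by blast
      let ?V = "\<Union>i<n. B i"
      have "prob (sym_diff (\<Union>i. a i) ?V) \<le> prob (((\<Union>i. a i) - ?U n) \<union> (\<Union>i<n. sym_diff (a i) (B i)))"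
        using a BM by (intro finite_measure_mono) auto
      also have "\<dots> \<le> prob ((\<Union>i. a i) - ?U n) + prob (\<Union>i<n. sym_diff (a i) (B i))"
        using a BM by (intro measure_Un_le) auto
      also have "prob ((\<Union>i. a i) - ?U n) = prob (\<Union>i. a i) - prob (?U n)"
        using a by (intro finite_measure_Diff) auto
      also have "prob (\<Union>i<n. sym_diff (a i) (B i)) \<le> (\<Sum>i<n. prob (sym_diff (a i) (B i)))"
        using a BM by (intro finite_measure_subadditive_finite) auto
      also have "(\<Sum>i<n. prob (sym_diff (a i) (B i))) \<le> real n * (e / (2 * (real n + 1)))"
        using sum_bounded_above[of "{..<n}" "\<lambda>i. prob (sym_diff (a i) (B i))", OF less_imp_le[OF B(2)]]
        by simp
      also have "\<dots> \<le> e / 2" using e by (simp add: field_simps)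
      finally have "prob (sym_diff (\<Union>i. a i) ?V) < e" using n by simp
      moreover have "?V \<in> R" using B by blast
      ultimately show ?thesis by blast
    qed
    then show ?case using a by blast
  qed
  then show ?thesis using e by blast
qed

section \<open>The extended shift\<close>

locale extended_shift =
  fixes m_minus m_plus :: nat and \<phi> :: "nat \<Rightarrow> nat" and p :: "nat \<Rightarrow> real"
  assumes m_plus_pos: "0 < m_plus"
    and phi: "\<phi> ` {..<m_plus} = {..<m_minus}"
    and p_nonneg: "\<forall>s<m_plus. 0 \<le> p s" and p_sum: "(\<Sum>s<m_plus. p s) = 1"
begin

abbreviation "coord_measure i \<equiv>
  point_measure (alphabet m_minus m_plus i) (\<lambda>s. ennreal (symbol_distr m_plus \<phi> p i s))"

abbreviation "\<mu> \<equiv> ext_measure m_minus m_plus \<phi> p"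

lemma phi_sub: "\<phi> ` {..<m_plus} \<subseteq> {..<m_minus}"
  using phi by simp

sublocale coords: product_prob_space coord_measure UNIV
  by (rule product_prob_space_ext_measure[OF phi_sub p_nonneg p_sum])

sublocale prob_space \<mu>
  by (rule prob_space_ext_measure[OF phi_sub p_nonneg p_sum])

lemma in_space_iff: "x \<in> space \<mu> \<longleftrightarrow> (\<forall>i. x i \<in> alphabet m_minus m_plus i)"
  by (simp add: space_ext_measure ext_space_def)

lemma emeasure_coord_measure:
  "A \<subseteq> alphabet m_minus m_plus i \<Longrightarrow>
    emeasure (coord_measure i) A = ennreal (\<Sum>s\<in>A. symbol_distr m_plus \<phi> p i s)"
  using symbol_distr_prob(1)[OF phi_sub p_nonneg p_sum]
  by (subst emeasure_point_measure_finite) (auto intro!: sum_ennreal)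

text \<open>Lets the shift act on each coordinate separately, with \<phi> applied only on the
  passage from position 0 to -1.\<close>

definition step :: "int \<Rightarrow> nat \<Rightarrow> nat" where
  "step i = (if i = -1 then \<phi> else id)"

lemma ext_shift_eq_step: "ext_shift \<phi> x = (\<lambda>i. step i (x (i + 1)))"
  by (auto simp: ext_shift_def step_def)

lemma step_alphabet: "s \<in> alphabet m_minus m_plus (i + 1) \<Longrightarrow> step i s \<in> alphabet m_minus m_plus i"
  using phi_sub by (auto simp: step_def alphabet_def split: if_splits)

text \<open>Invariance seen at one coordinate. At \<open>i = -1\<close> it is the definition of the
  pushforward summed over \<open>A\<close>; elsewhere \<open>i\<close> and \<open>i + 1\<close>
  carry the same alphabet and law.\<close>

lemma emeasure_step:
  assumes A: "A \<subseteq> alphabet m_minus m_plus i"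
  shows "emeasure (coord_measure (i + 1)) (step i -` A \<inter> alphabet m_minus m_plus (i + 1)) = emeasure (coord_measure i) A"
proof (cases "i = -1")
  case True
  have fin: "finite A" using A finite_alphabet finite_subset by blast
  have "(\<Sum>s\<in>\<phi> -` A \<inter> {..<m_plus}. p s) = (\<Sum>z\<in>A. \<Sum>s\<in>{s \<in> \<phi> -` A \<inter> {..<m_plus}. \<phi> s = z}. p s)"
    by (rule sum.group[symmetric]) (use fin in auto)
  also have "\<dots> = (\<Sum>z\<in>A. pushforward_distr m_plus \<phi> p z)"
    unfolding pushforward_distr_def by (intro sum.cong) auto
  finally have "(\<Sum>s\<in>\<phi> -` A \<inter> {..<m_plus}. p s) = (\<Sum>z\<in>A. pushforward_distr m_plus \<phi> p z)" .
  moreover have "A \<subseteq> {..<m_minus}" using A True by (simp add: alphabet_def)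
  ultimately show ?thesis
    unfolding emeasure_coord_measure[OF A] emeasure_coord_measure[OF Int_lower2]
    using True by (simp add: step_def symbol_distr_def alphabet_def)
next
  case False
  then have "i + 1 < 0 \<longleftrightarrow> i < 0" by auto
  then have "alphabet m_minus m_plus (i + 1) = alphabet m_minus m_plus i"
    "symbol_distr m_plus \<phi> p (i + 1) = symbol_distr m_plus \<phi> p i"
    by (simp_all add: alphabet_def symbol_distr_def)
  moreover have "step i -` A \<inter> alphabet m_minus m_plus i = A" using False A by (auto simp: step_def)
  ultimately show ?thesis by simp
qed

section \<open>Invariance of the measure and iterates of the shift\<close>

lemma measurable_ext_shift: "ext_shift \<phi> \<in> measurable \<mu> \<mu>"
proof -
  have "(\<lambda>x i. step i (x (i + 1))) \<in> measurable \<mu> (Pi\<^sub>M UNIV coord_measure)"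
  proof (rule measurable_PiM_single')
    fix i :: int
    have "(\<lambda>x. x (i + 1)) \<in> measurable \<mu> (coord_measure (i + 1))"
      unfolding ext_measure_def by (rule measurable_component_singleton) simp
    then show "(\<lambda>x. step i (x (i + 1))) \<in> measurable \<mu> (coord_measure i)"
      by (rule measurable_compose) (auto simp: space_point_measure step_alphabet)
  qed (auto simp: in_space_iff space_point_measure step_alphabet)
  then show ?thesis by (simp add: ext_shift_eq_step[abs_def] ext_measure_def)
qed

text \<open>A product measure is determined by its finite-dimensional boxes. The preimage of a box
  over \<open>J\<close> is a box over \<open>J\<close> moved by one, and
  \<open>emeasure_step\<close> compares the factors.\<close>

lemma distr_ext_shift: "distr \<mu> \<mu> (ext_shift \<phi>) = \<mu>"
proof -
  have "distr \<mu> \<mu> (ext_shift \<phi>) = Pi\<^sub>M UNIV coord_measure"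
  proof (rule coords.PiM_eq)
    show "sets (distr \<mu> \<mu> (ext_shift \<phi>)) = sets (Pi\<^sub>M UNIV coord_measure)"
      by (simp add: ext_measure_def)
  next
    fix J :: "int set" and F
    assume J: "finite J" and "J \<subseteq> UNIV" and F: "\<And>j. j \<in> J \<Longrightarrow> F j \<in> sets (coord_measure j)"
    let ?F' = "\<lambda>j. step (j - 1) -` F (j - 1) \<inter> alphabet m_minus m_plus j"
    let ?J' = "(\<lambda>j. j + 1) ` J"
    have F': "F j \<subseteq> alphabet m_minus m_plus j" if "j \<in> J" for j
      using F[OF that] by (simp add: sets_point_measure)
    have emb: "prod_emb UNIV coord_measure J (Pi\<^sub>E J F) \<in> sets \<mu>"
      unfolding ext_measure_def using J F by (intro sets_PiM_I) auto
    have "ext_shift \<phi> -` prod_emb UNIV coord_measure J (Pi\<^sub>E J F) \<inter> space \<mu>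
        = {x \<in> space (Pi\<^sub>M UNIV coord_measure). \<forall>j\<in>?J'. x j \<in> ?F' j}"
      using F' measurable_space[OF measurable_ext_shift]
      by (auto simp: prod_emb_iff PiE_iff ext_shift_eq_step in_space_iff space_point_measure ext_measure_def[symmetric] step_alphabet)
    then have "emeasure (distr \<mu> \<mu> (ext_shift \<phi>)) (prod_emb UNIV coord_measure J (Pi\<^sub>E J F))
        = emeasure (Pi\<^sub>M UNIV coord_measure) {x \<in> space (Pi\<^sub>M UNIV coord_measure). \<forall>j\<in>?J'. x j \<in> ?F' j}"
      using emeasure_distr[OF measurable_ext_shift emb] by (simp add: ext_measure_def)
    also have "\<dots> = (\<Prod>j\<in>?J'. emeasure (coord_measure j) (?F' j))"
      using J by (intro coords.emeasure_PiM_Collect) (auto simp: sets_point_measure)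
    also have "\<dots> = (\<Prod>j\<in>J. emeasure (coord_measure (j + 1)) (?F' (j + 1)))"
      by (subst prod.reindex) (auto simp: inj_on_def)
    also have "\<dots> = (\<Prod>j\<in>J. emeasure (coord_measure j) (F j))"
      using F' by (intro prod.cong refl) (simp add: emeasure_step)
    finally show "emeasure (distr \<mu> \<mu> (ext_shift \<phi>)) (prod_emb UNIV coord_measure J (Pi\<^sub>E J F))
        = (\<Prod>j\<in>J. emeasure (coord_measure j) (F j))" .
  qed
  then show ?thesis by (simp add: ext_measure_def)
qed

sublocale measure_preserving_map \<mu> "ext_shift \<phi>"
  by standard (rule measurable_ext_shift distr_ext_shift)+

text \<open>A symbol changes only when it crosses from position 0 to -1, hence at most once, and
  whether it has crossed depends on \<open>n\<close> and \<open>j\<close> alone.\<close>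

lemma ext_shift_iterate:
  "(ext_shift \<phi> ^^ n) x j = (if j < 0 \<and> 0 \<le> j + int n then \<phi> (x (j + int n)) else x (j + int n))"
proof (induction n arbitrary: j)
  case (Suc n)
  have "(ext_shift \<phi> ^^ Suc n) x j =
      (if j = -1 then \<phi> ((ext_shift \<phi> ^^ n) x 0) else (ext_shift \<phi> ^^ n) x (j + 1))"
    by (simp add: ext_shift_def)
  then show ?case using Suc.IH[of 0] Suc.IH[of "j + 1"] by (auto simp: algebra_simps)
qed simp

section \<open>Entropy of the coordinates\<close>

lemma fibre_coord: "fibre \<mu> (\<lambda>x. x i) s = cylinder m_minus m_plus i s"
  by (auto simp: fibre_def cylinder_def space_ext_measure)

lemma labelling_coord: "labelling \<mu> (\<lambda>x. x i)"
proof -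
  have "(\<lambda>x. x i) \<in> measurable \<mu> (coord_measure i)"
    unfolding ext_measure_def by (rule measurable_component_singleton) simp
  then show ?thesis by (rule measurable_compose[where g = "\<lambda>s. s"]) simp
qed

lemma prob_fibre_coord:
  "s \<in> alphabet m_minus m_plus i \<Longrightarrow> prob (fibre \<mu> (\<lambda>x. x i) s) = symbol_distr m_plus \<phi> p i s"
  by (simp add: fibre_coord measure_cylinder[OF phi_sub p_nonneg p_sum] symbol_distr_def)

lemma label_entropy_coord:
  "label_entropy \<mu> (\<lambda>x. x i) =
    ennreal (\<Sum>s\<in>alphabet m_minus m_plus i. - symbol_distr m_plus \<phi> p i s * ln (symbol_distr m_plus \<phi> p i s))"
proof -
  let ?q = "\<lambda>s. prob (fibre \<mu> (\<lambda>x. x i) s)"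
  have "fibre \<mu> (\<lambda>x. x i) s = {}" if "s \<notin> alphabet m_minus m_plus i" for s
    using that by (auto simp: fibre_def in_space_iff)
  then have "label_entropy \<mu> (\<lambda>x. x i) = (\<Sum>s\<in>alphabet m_minus m_plus i. ennreal (- ?q s * ln (?q s)))"
    unfolding label_entropy_count_space[OF labelling_coord]
    by (intro nn_integral_count_space') auto
  also have "\<dots> = ennreal (\<Sum>s\<in>alphabet m_minus m_plus i. - ?q s * ln (?q s))"
  proof (rule sum_ennreal)
    show "0 \<le> - ?q s * ln (?q s)" for s
      by (cases "?q s = 0") (auto simp: zero_less_measure_iff mult_nonneg_nonpos)
  qed
  also have "(\<Sum>s\<in>alphabet m_minus m_plus i. - ?q s * ln (?q s)) =
      (\<Sum>s\<in>alphabet m_minus m_plus i. - symbol_distr m_plus \<phi> p i s * ln (symbol_distr m_plus \<phi> p i s))"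
    by (intro sum.cong refl) (simp add: prob_fibre_coord)
  finally show ?thesis .
qed

abbreviation "plus_entropy \<equiv> (\<Sum>s<m_plus. - p s * ln (p s))"

abbreviation "minus_entropy \<equiv>
  (\<Sum>s<m_minus. - pushforward_distr m_plus \<phi> p s * ln (pushforward_distr m_plus \<phi> p s))"

lemma label_entropy_coord_nonneg: "0 \<le> i \<Longrightarrow> label_entropy \<mu> (\<lambda>x. x i) = ennreal plus_entropy"
  by (simp add: label_entropy_coord alphabet_def symbol_distr_def)

lemma label_entropy_coord_neg: "i < 0 \<Longrightarrow> label_entropy \<mu> (\<lambda>x. x i) = ennreal minus_entropy"
  by (simp add: label_entropy_coord alphabet_def symbol_distr_def)

lemma zero_partition_eq: "zero_partition m_minus m_plus = fibre_partition \<mu> (\<lambda>x. x 0)"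
proof -
  \<comment> \<open>The negative alphabet is nonempty, so any symbol at position 0 extends to a
    point of the space and every cylinder really is a fibre over an attained value.\<close>
  have "\<phi> 0 \<in> {..<m_minus}" unfolding phi[symmetric] using m_plus_pos by blast
  then have "0 < m_minus" by auto
  then have "(\<lambda>i. if i = 0 then s else 0) \<in> space \<mu>" if "s < m_plus" for s
    using that m_plus_pos by (auto simp: in_space_iff alphabet_def)
  then have "s \<in> (\<lambda>x. x 0) ` space \<mu>" if "s < m_plus" for s
    using that by (intro image_eqI[of _ _ "\<lambda>i. if i = 0 then s else 0"]) auto
  moreover have "x 0 < m_plus" if "x \<in> space \<mu>" for x
    using that by (auto simp: in_space_iff alphabet_def dest: spec[of _ 0])
  ultimately have "(\<lambda>x. x 0) ` space \<mu> = {..<m_plus}" by blast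
  then show ?thesis
    unfolding zero_partition_def fibre_partition_def by (simp add: fibre_coord)
qed

lemma countable_partition_zero: "countable_partition \<mu> (zero_partition m_minus m_plus)"
  unfolding countable_partition_def
proof (intro conjI)
  show "countable (zero_partition m_minus m_plus)" by (simp add: zero_partition_def)
  show "zero_partition m_minus m_plus \<subseteq> sets \<mu>"
    unfolding zero_partition_eq fibre_partition_def using sets_fibre[OF labelling_coord] by auto
  show "partition_on (space \<mu>) (zero_partition m_minus m_plus)"
    unfolding zero_partition_eq fibre_partition_def
    by (rule partition_onI) (auto simp: fibre_def disjnt_def)
qed

text \<open>The iterates bring the coordinates 0 to \<open>n - 1\<close> to position 0 unchanged,
  and under the product measure these are independent with law \<open>p\<close>.\<close>

lemma label_entropy_itinerary_coord:
  "label_entropy \<mu> (itinerary (\<lambda>x. x 0) n) = of_nat n * ennreal plus_entropy"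
proof -
  have it: "itinerary (\<lambda>x. x 0) = joint (\<lambda>i x. x (int i))"
    by (simp add: itinerary_def ext_shift_iterate)
  have "label_entropy \<mu> (joint (\<lambda>i x. x (int i)) n) = (\<Sum>i<n. label_entropy \<mu> (\<lambda>x. x (int i)))"
  proof (rule label_entropy_joint_indep[OF labelling_coord])
    fix x assume x: "x \<in> space \<mu>"
    let ?J = "int ` {..<n}"
    have "fibre \<mu> (joint (\<lambda>i x. x (int i)) n) (joint (\<lambda>i x. x (int i)) n x)
        = prod_emb UNIV coord_measure ?J (Pi\<^sub>E ?J (\<lambda>j. {x j}))"
      unfolding fibre_joint by (auto simp: prod_emb_iff PiE_iff in_space_iff space_point_measure)
    then have "prob (fibre \<mu> (joint (\<lambda>i x. x (int i)) n) (joint (\<lambda>i x. x (int i)) n x))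
        = (\<Prod>j\<in>?J. measure (coord_measure j) {x j})"
      unfolding ext_measure_def using x
      by (simp add: coords.measure_PiM_emb sets_point_measure in_space_iff)
    also have "\<dots> = (\<Prod>i<n. measure (coord_measure (int i)) {x (int i)})"
      by (subst prod.reindex) auto
    also have "\<dots> = (\<Prod>i<n. prob (fibre \<mu> (\<lambda>x. x (int i)) (x (int i))))"
    proof (rule prod.cong[OF refl])
      fix i
      have a: "x (int i) \<in> alphabet m_minus m_plus (int i)" using x by (simp add: in_space_iff)
      then have "measure (coord_measure (int i)) {x (int i)} = symbol_distr m_plus \<phi> p (int i) (x (int i))"
        using symbol_distr_prob(1)[OF phi_sub p_nonneg p_sum a]
        by (simp add: measure_def emeasure_coord_measure)
      then show "measure (coord_measure (int i)) {x (int i)} = prob (fibre \<mu> (\<lambda>x. x (int i)) (x (int i)))"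
        using prob_fibre_coord[OF a] by simp
    qed
    finally show "prob (fibre \<mu> (joint (\<lambda>i x. x (int i)) n) (joint (\<lambda>i x. x (int i)) n x))
        = (\<Prod>i<n. prob (fibre \<mu> (\<lambda>x. x (int i)) (x (int i))))" .
  qed
  then show ?thesis by (simp add: it label_entropy_coord_nonneg)
qed

section \<open>Labels that depend on a finite window\<close>

definition depends_on :: "nat \<Rightarrow> ((int \<Rightarrow> nat) \<Rightarrow> 'b) \<Rightarrow> bool" where
  "depends_on N X \<longleftrightarrow> (\<forall>x\<in>space \<mu>. \<forall>y\<in>space \<mu>. (\<forall>j. \<bar>j\<bar> \<le> int N \<longrightarrow> x j = y j) \<longrightarrow> X x = X y)"

lemma depends_onI:
  "(\<And>x y. x \<in> space \<mu> \<Longrightarrow> y \<in> space \<mu> \<Longrightarrow> (\<And>j. \<bar>j\<bar> \<le> int N \<Longrightarrow> x j = y j) \<Longrightarrow> X x = X y) \<Longrightarrow> depends_on N X"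
  unfolding depends_on_def by (intro ballI impI) blast

lemma depends_onD:
  "depends_on N X \<Longrightarrow> x \<in> space \<mu> \<Longrightarrow> y \<in> space \<mu> \<Longrightarrow> (\<And>j. \<bar>j\<bar> \<le> int N \<Longrightarrow> x j = y j) \<Longrightarrow> X x = X y"
  unfolding depends_on_def by (elim ballE[of _ _ x] ballE[of _ _ y] impE) auto

lemma depends_on_mono:
  assumes "depends_on N X" "N \<le> N'"
  shows "depends_on N' X"
proof (rule depends_onI)
  fix x y assume xy: "x \<in> space \<mu>" "y \<in> space \<mu>" "\<And>j. \<bar>j\<bar> \<le> int N' \<Longrightarrow> x j = y j"
  show "X x = X y"
    using assms(2) by (intro depends_onD[OF assms(1) xy(1,2)] xy(3)) simp
qed

text \<open>The window may vary with the set; a union of two takes the larger one. The cylinders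
  belong to this family, so it generates the sigma-algebra.\<close>

definition local_sets :: "(int \<Rightarrow> nat) set set" where
  "local_sets = {B \<in> sets \<mu>. \<exists>N. depends_on N (\<lambda>x. x \<in> B)}"

lemma algebra_local_sets: "algebra (space \<mu>) local_sets"
  unfolding algebra_iff_Un
proof (intro conjI ballI)
  show "local_sets \<subseteq> Pow (space \<mu>)"
    unfolding local_sets_def using sets.sets_into_space by auto
  show "{} \<in> local_sets" by (auto simp: local_sets_def depends_on_def)
next
  fix A assume "A \<in> local_sets"
  then obtain N where A: "A \<in> sets \<mu>" "depends_on N (\<lambda>x. x \<in> A)"
    by (auto simp: local_sets_def)
  have "depends_on N (\<lambda>x. x \<in> space \<mu> - A)"
  proof (rule depends_onI)
    fix x y assume xy: "x \<in> space \<mu>" "y \<in> space \<mu>" "\<And>j. \<bar>j\<bar> \<le> int N \<Longrightarrow> x j = y j"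
    show "(x \<in> space \<mu> - A) = (y \<in> space \<mu> - A)"
      using depends_onD[OF A(2) xy] xy(1,2) by simp
  qed
  then show "space \<mu> - A \<in> local_sets"
    using A(1) by (auto simp: local_sets_def)
next
  fix A B assume "A \<in> local_sets" "B \<in> local_sets"
  then obtain N N' where A: "A \<in> sets \<mu>" "depends_on N (\<lambda>x. x \<in> A)"
      and B: "B \<in> sets \<mu>" "depends_on N' (\<lambda>x. x \<in> B)"
    by (auto simp: local_sets_def)
  have AB: "depends_on (max N N') (\<lambda>x. x \<in> A)" "depends_on (max N N') (\<lambda>x. x \<in> B)"
    using A B by (auto intro: depends_on_mono)
  have "depends_on (max N N') (\<lambda>x. x \<in> A \<union> B)"
  proof (rule depends_onI)
    fix x y assume xy: "x \<in> space \<mu>" "y \<in> space \<mu>" "\<And>j. \<bar>j\<bar> \<le> int (max N N') \<Longrightarrow> x j = y j"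
    show "(x \<in> A \<union> B) = (y \<in> A \<union> B)"
      using depends_onD[OF AB(1) xy] depends_onD[OF AB(2) xy] by simp
  qed
  then show "A \<union> B \<in> local_sets" using A B by (auto simp: local_sets_def)
qed

lemma sets_eq_sigma_local_sets: "sets \<mu> = sigma_sets (space \<mu>) local_sets"
proof
  have "{cylinder m_minus m_plus i s | i s. s \<in> alphabet m_minus m_plus i} \<subseteq> local_sets"
  proof clarify
    fix i s
    have "depends_on (nat \<bar>i\<bar>) (\<lambda>x. x \<in> cylinder m_minus m_plus i s)"
      by (auto simp: depends_on_def cylinder_def space_ext_measure)
    then show "cylinder m_minus m_plus i s \<in> local_sets"
      using sets_fibre[OF labelling_coord] by (auto simp: local_sets_def fibre_coord)
  qed
  then show "sets \<mu> \<subseteq> sigma_sets (space \<mu>) local_sets"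
    unfolding sets_ext_measure space_ext_measure by (rule sigma_sets_mono')
  show "sigma_sets (space \<mu>) local_sets \<subseteq> sets \<mu>"
    by (rule sets.sigma_sets_subset) (auto simp: local_sets_def)
qed

text \<open>Agreement is asked for only where \<open>X\<close> is below \<open>K\<close>, so
  finitely many fibres have to be approximated and one window suffices for all of them.\<close>

lemma local_approximation:
  fixes X :: "(int \<Rightarrow> nat) \<Rightarrow> nat"
  assumes X: "labelling \<mu> X" and d: "0 < d"
  obtains X' :: "(int \<Rightarrow> nat) \<Rightarrow> nat" and N
  where "labelling \<mu> X'" "depends_on N X'" "prob {x \<in> space \<mu>. X x < K \<and> X x \<noteq> X' x} \<le> d"
proof -
  have "\<forall>k. \<exists>B\<in>local_sets. prob (sym_diff (fibre \<mu> X k) B) < d / (real K + 1)"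
    using approx_by_algebra[OF algebra_local_sets sets_eq_sigma_local_sets sets_fibre[OF X]] d by simp
  then obtain B where B: "\<And>k. B k \<in> local_sets" "\<And>k. prob (sym_diff (fibre \<mu> X k) (B k)) < d / (real K + 1)"
    by metis
  have BM: "B k \<in> sets \<mu>" for k using B(1) by (simp add: local_sets_def)
  obtain N where N: "\<And>k. depends_on (N k) (\<lambda>x. x \<in> B k)"
    using B(1) unfolding local_sets_def by simp metis
  \<comment> \<open>The sum dominates every \<open>N k\<close> with \<open>k < K\<close> and is also
    defined for \<open>K = 0\<close>.\<close>
  define N' where "N' = (\<Sum>k<K. N k)"
  have N': "depends_on N' (\<lambda>x. x \<in> B k)" if "k < K" for k
    using that unfolding N'_def by (intro depends_on_mono[OF N] member_le_sum) auto
  \<comment> \<open>The sets \<open>B k\<close> may overlap or miss points: the least index settles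
    overlaps, and \<open>K\<close>, which satisfies the condition vacuously, is the default.\<close>
  define X' where "X' x = (LEAST k. k < K \<longrightarrow> x \<in> B k)" for x
  have X'_cong: "X' x = X' y" if "\<And>k. k < K \<Longrightarrow> x \<in> B k \<longleftrightarrow> y \<in> B k" for x y
  proof -
    have "(\<lambda>k. k < K \<longrightarrow> x \<in> B k) = (\<lambda>k. k < K \<longrightarrow> y \<in> B k)" using that by blast
    then show ?thesis unfolding X'_def by simp
  qed
  show thesis
  proof
    have "labelling \<mu> (joint (\<lambda>k x. x \<in> B k) K)"
      using BM by (intro labelling_joint) (simp add: pred_def[symmetric] Measurable.pred_sets1)
    then show "labelling \<mu> X'"
      by (rule labelling_factor) (auto simp: joint_eq_iff intro!: X'_cong)
    show "depends_on N' X'"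
    proof (intro depends_onI X'_cong)
      fix x y k assume xy: "x \<in> space \<mu>" "y \<in> space \<mu>" "\<And>j. \<bar>j\<bar> \<le> int N' \<Longrightarrow> x j = y j" and "k < K"
      then show "x \<in> B k \<longleftrightarrow> y \<in> B k" by (intro depends_onD[OF N'])
    qed
    have "{x \<in> space \<mu>. X x < K \<and> X x \<noteq> X' x} \<subseteq> (\<Union>k<K. sym_diff (fibre \<mu> X k) (B k))"
    proof clarify
      fix x assume x: "x \<in> space \<mu>" "X x < K" and neq: "X x \<noteq> X' x"
      show "x \<in> (\<Union>k<K. sym_diff (fibre \<mu> X k) (B k))"
      proof (rule ccontr)
        assume "\<not> ?thesis"
        then have mem: "x \<notin> sym_diff (fibre \<mu> X k) (B k)" if "k < K" for k
          using that by blast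
        \<comment> \<open>Outside all the symmetric differences, \<open>X x\<close> is the only
          index below \<open>K\<close> whose set contains \<open>x\<close>.\<close>
        have iff: "x \<in> B k \<longleftrightarrow> X x = k" if "k < K" for k
          using mem[OF that] x(1) by (auto simp: fibre_def)
        have "X' x = X x"
          unfolding X'_def
        proof (rule Least_equality)
          show "X x < K \<longrightarrow> x \<in> B (X x)" using iff by simp
          show "X x \<le> k" if "k < K \<longrightarrow> x \<in> B k" for k
            using iff[of k] that x(2) by (cases "k < K") auto
        qed
        then show False using neq by simp
      qed
    qed
    then have "prob {x \<in> space \<mu>. X x < K \<and> X x \<noteq> X' x} \<le> prob (\<Union>k<K. sym_diff (fibre \<mu> X k) (B k))"
      using BM sets_fibre[OF X] by (intro finite_measure_mono) auto
    also have "\<dots> \<le> (\<Sum>k<K. prob (sym_diff (fibre \<mu> X k) (B k)))"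
      using BM sets_fibre[OF X] by (intro finite_measure_subadditive_finite) auto
    also have "\<dots> \<le> real K * (d / (real K + 1))"
      using sum_bounded_above[of "{..<K}" "\<lambda>k. prob (sym_diff (fibre \<mu> X k) (B k))", OF less_imp_le[OF B(2)]]
      by simp
    also have "\<dots> \<le> d" using d by (simp add: field_simps)
    finally show "prob {x \<in> space \<mu>. X x < K \<and> X x \<noteq> X' x} \<le> d" .
  qed
qed

text \<open>The window moves right with time, so its left end never passes \<open>- N\<close>;
  subadditivity over the \<open>2 * N + n\<close> coordinates seen then gives the bound.\<close>

lemma label_entropy_itinerary_local:
  fixes X :: "(int \<Rightarrow> nat) \<Rightarrow> nat"
  assumes dep: "depends_on N X"
  shows "label_entropy \<mu> (itinerary X n) \<le>
    of_nat N * ennreal minus_entropy + of_nat (N + n) * ennreal plus_entropy"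
proof -
  \<comment> \<open>The offset makes the indices \<open>i < N\<close> the negative
    coordinates.\<close>
  let ?Y = "\<lambda>i x. x (int i - int N)"
  have split: "(\<Sum>i<N + m. g i) = (\<Sum>i<N. g i) + (\<Sum>i<m. g (N + i))" for g :: "nat \<Rightarrow> ennreal" and m
    by (induction m) (auto simp: add.assoc)
  have "label_entropy \<mu> (itinerary X n) \<le> label_entropy \<mu> (joint ?Y (N + (N + n)))"
  proof (rule label_entropy_mono[OF labelling_joint[OF labelling_coord]])
    fix x y assume xy: "x \<in> space \<mu>" "y \<in> space \<mu>" and "joint ?Y (N + (N + n)) x = joint ?Y (N + (N + n)) y"
    then have eq: "x (int i - int N) = y (int i - int N)" if "i < N + (N + n)" for i
      using that by (simp add: joint_eq_iff)
    have "X ((ext_shift \<phi> ^^ i) x) = X ((ext_shift \<phi> ^^ i) y)" if i: "i < n" for i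
    proof -
      have "(ext_shift \<phi> ^^ i) x j = (ext_shift \<phi> ^^ i) y j" if "\<bar>j\<bar> \<le> int N" for j
      proof -
        have "0 \<le> j + int i + int N" "nat (j + int i + int N) < N + (N + n)"
          using that i by auto
        then have "x (j + int i) = y (j + int i)"
          using eq[of "nat (j + int i + int N)"] by simp
        \<comment> \<open>Both points have \<phi> applied at the same positions, so equality of the
          original coordinates suffices.\<close>
        then show ?thesis by (simp add: ext_shift_iterate)
      qed
      then show ?thesis
        using xy by (intro depends_onD[OF dep] measurable_space[OF measurable_iterate])
    qed
    then show "itinerary X n x = itinerary X n y" by (simp add: itinerary_eq_iff)
  qed
  also have "\<dots> \<le> (\<Sum>i<N + (N + n). label_entropy \<mu> (?Y i))"
    by (rule label_entropy_joint_le[OF labelling_coord])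
  also have "\<dots> = (\<Sum>i<N. label_entropy \<mu> (?Y i)) + (\<Sum>i<N + n. label_entropy \<mu> (?Y (N + i)))"
    by (rule split)
  also have "\<dots> = of_nat N * ennreal minus_entropy + of_nat (N + n) * ennreal plus_entropy"
    by (simp add: label_entropy_coord_neg label_entropy_coord_nonneg)
  finally show ?thesis .
qed

text \<open>Makes arithmetic inside \<open>ennreal\<close> exact. The weights are fibre
  probabilities, hence at most 1.\<close>

lemma entropy_nonneg: "0 \<le> plus_entropy" "0 \<le> minus_entropy"
proof -
  have "0 \<le> - q s * ln (q s)" if "0 \<le> q s" "q s \<le> 1" for q :: "nat \<Rightarrow> real" and s
    using that by (cases "q s = 0") (auto simp: mult_nonneg_nonpos)
  note * = this
  show "0 \<le> plus_entropy"
  proof (rule sum_nonneg)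
    fix s assume s: "s \<in> {..<m_plus}"
    have "p s = prob (fibre \<mu> (\<lambda>x. x 0) s)"
      using s by (subst prob_fibre_coord) (auto simp: alphabet_def symbol_distr_def)
    then show "0 \<le> - p s * ln (p s)" by (intro *) auto
  qed
  show "0 \<le> minus_entropy"
  proof (rule sum_nonneg)
    fix s assume s: "s \<in> {..<m_minus}"
    have "pushforward_distr m_plus \<phi> p s = prob (fibre \<mu> (\<lambda>x. x (-1)) s)"
      using s by (subst prob_fibre_coord) (auto simp: alphabet_def symbol_distr_def)
    then show "0 \<le> - pushforward_distr m_plus \<phi> p s * ln (pushforward_distr m_plus \<phi> p s)"
      by (intro *) auto
  qed
qed

section \<open>Upper and lower bound for the entropy\<close>

lemma entropy_rate_le_plus_entropy:
  fixes X :: "(int \<Rightarrow> nat) \<Rightarrow> nat"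
  assumes X: "labelling \<mu> X" "label_entropy \<mu> X < \<infinity>"
  shows "lim (\<lambda>n. label_entropy \<mu> (itinerary X n) / of_nat n) \<le> ennreal plus_entropy"
proof (rule entropy_rate_le[OF X entropy_nonneg(1)])
  fix K :: nat and d :: real assume "0 < d"
  then obtain X' :: "(int \<Rightarrow> nat) \<Rightarrow> nat" and N
    where X': "labelling \<mu> X'" "depends_on N X'" "prob {x \<in> space \<mu>. X x < K \<and> X x \<noteq> X' x} \<le> d"
    by (rule local_approximation[OF X(1)])
  \<comment> \<open>The part of the window bound that does not grow with \<open>n\<close>.\<close>
  let ?C = "real N * (minus_entropy + plus_entropy)"
  have "label_entropy \<mu> (itinerary X' n) \<le> ennreal (?C + real n * plus_entropy)" for n
  proof -
    have "of_nat N * ennreal minus_entropy + of_nat (N + n) * ennreal plus_entropy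
        = ennreal (real N * minus_entropy + real (N + n) * plus_entropy)"
      using entropy_nonneg
      by (subst ennreal_plus) (auto simp: ennreal_of_nat_eq_real_of_nat ennreal_mult simp del: of_nat_add)
    also have "real N * minus_entropy + real (N + n) * plus_entropy = ?C + real n * plus_entropy"
      by (simp add: algebra_simps)
    finally show ?thesis using label_entropy_itinerary_local[OF X'(2), of n] by simp
  qed
  moreover have "0 \<le> ?C" using entropy_nonneg by (intro mult_nonneg_nonneg add_nonneg_nonneg) auto
  ultimately show "\<exists>X' :: (int \<Rightarrow> nat) \<Rightarrow> nat. \<exists>C. labelling \<mu> X' \<and>
      prob {x \<in> space \<mu>. X x < K \<and> X x \<noteq> X' x} \<le> d \<and> 0 \<le> C \<and>
      (\<forall>n\<ge>1. label_entropy \<mu> (itinerary X' n) \<le> ennreal (C + real n * plus_entropy))"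
    using X' by blast
qed

lemma partition_entropy_zero_partition:
  "partition_entropy \<mu> (zero_partition m_minus m_plus) = ennreal plus_entropy"
  by (simp only: zero_partition_eq partition_entropy_fibre_partition[OF labelling_coord]
    label_entropy_coord_nonneg order_refl)

lemma ks_entropy_eq: "ks_entropy \<mu> (ext_shift \<phi>) = ennreal plus_entropy"
  unfolding ks_entropy_def
proof (rule antisym)
  let ?rate = "\<lambda>P. lim (\<lambda>n. partition_entropy \<mu> (iterated_partition \<mu> (ext_shift \<phi>) P n) / of_nat n)"
  show "(SUP P\<in>{P. countable_partition \<mu> P \<and> partition_entropy \<mu> P < \<infinity>}. ?rate P) \<le> ennreal plus_entropy"
  proof (rule SUP_least)
    fix P assume "P \<in> {P. countable_partition \<mu> P \<and> partition_entropy \<mu> P < \<infinity>}"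
    then have P: "countable_partition \<mu> P" and fin: "partition_entropy \<mu> P < \<infinity>" by auto
    obtain X :: "(int \<Rightarrow> nat) \<Rightarrow> nat" where X: "labelling \<mu> X" "P = fibre_partition \<mu> X"
      by (rule countable_partition_imp_labelling[OF P])
    then have "label_entropy \<mu> X < \<infinity>"
      using fin by (simp add: partition_entropy_fibre_partition)
    then show "?rate P \<le> ennreal plus_entropy"
      unfolding X(2) entropy_rate_eq[OF X(1)] by (rule entropy_rate_le_plus_entropy[OF X(1)])
  qed
  \<comment> \<open>Lower bound: the partition by coordinate 0 has finite entropy and already
    attains the value.\<close>
  have "(\<lambda>n. label_entropy \<mu> (itinerary (\<lambda>x. x 0) n) / of_nat n) \<longlonglongrightarrow> ennreal plus_entropy"
  proof (rule tendsto_eventually)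
    show "\<forall>\<^sub>F n in sequentially. label_entropy \<mu> (itinerary (\<lambda>x. x 0) n) / of_nat n = ennreal plus_entropy"
      using eventually_gt_at_top[of 0]
      by eventually_elim (simp only: label_entropy_itinerary_coord mult.commute[of "of_nat _"],
        subst ennreal_mult_divide_eq, auto)
  qed
  then have "ennreal plus_entropy = ?rate (zero_partition m_minus m_plus)"
    unfolding zero_partition_eq entropy_rate_eq[OF labelling_coord] by (rule limI[symmetric])
  also have "\<dots> \<le> (SUP P\<in>{P. countable_partition \<mu> P \<and> partition_entropy \<mu> P < \<infinity>}. ?rate P)"
    using countable_partition_zero partition_entropy_zero_partition by (intro SUP_upper) simp
  finally show "ennreal plus_entropy \<le> (SUP P\<in>{P. countable_partition \<mu> P \<and> partition_entropy \<mu> P < \<infinity>}. ?rate P)" .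
qed

end

theorem theoremA:
  fixes m_minus m_plus :: nat and \<phi> :: "nat \<Rightarrow> nat" and p :: "nat \<Rightarrow> real"
  assumes "0 < m_minus" and "0 < m_plus"
    and "\<phi> ` {..<m_plus} = {..<m_minus}"
    and "\<forall>s<m_plus. 0 \<le> p s" and "(\<Sum>s<m_plus. p s) = 1"
  shows "ks_entropy (ext_measure m_minus m_plus \<phi> p) (ext_shift \<phi>) =
           partition_entropy (ext_measure m_minus m_plus \<phi> p) (zero_partition m_minus m_plus)
       \<and> partition_entropy (ext_measure m_minus m_plus \<phi> p) (zero_partition m_minus m_plus) =
           ennreal (\<Sum>s<m_plus. - p s * ln (p s))"
proof -
  interpret extended_shift m_minus m_plus \<phi> p
    by standard (fact assms)+
  show ?thesis
    using ks_entropy_eq partition_entropy_zero_partition by simp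
qed

end
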